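(* Suppose given, in an abelian category, objects and morphisms $$a\xrightarrow{\alpha}b\xrightarrow{\beta}c\xrightarrow{\gamma}d,\qquad e\xrightarrow{\theta}f\xrightarrow{\iota}g\xrightarrow{\kappa}h,$$ $$\delta:a\to e,\quad \epsilon:b\to f,\quad \zeta:c\to g,\quad \eta:d\to h,$$ such that the resulting ladder commutes, i.e. $\alpha\cdot\epsilon=\delta\cdot\theta$, $\beta\cdot\zeta=\epsilon\cdot\iota$, $\gamma\cdot\eta=\zeta\cdot\kappa$. If the composition of any two consecutive horizontal morphisms is zero ($\alpha\cdot\beta=0$, $\beta\cdot\gamma=0$, $\theta\cdot\iota=0$, $\iota\cdot\kappa=0$), $\delta$ is an epimorphism, and $\eta$ is a monomorphism, then there is a monomorphism $$\mathrm{H}\big(\ker(\epsilon)\to\ker(\zeta)\to\mathrm{H}(\beta,\gamma)\big)\hookrightarrow\mathrm{coker}\big(\mathrm{H}(\alpha,\beta)\xrightarrow{\mathrm{H}(\epsilon)}\mathrm{H}(\theta,\iota)\big).$$ In particular, $\ker(\zeta)$ admits a filtration whose graded parts are given by subquotients of the three objects $\ker(\epsilon)$, $\mathrm{H}(\beta,\gamma)$, $\mathrm{H}(\theta,\iota)$. In particular, if these three objects are zero (i.e. if $\epsilon$ is a monomorphism and the diagram is exact at $c$ and $f$), then $\zeta$ is a monomorphism.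
   Context: Composition is written in diagrammatic order: $\alpha\cdot\beta$ means first $\alpha$, then $\beta$. For a composable pair $x\xrightarrow{\varphi}y\xrightarrow{\psi}z$ in an abelian category (not necessarily $\varphi\cdot\psi=0$), its homology $\mathrm{H}(\varphi,\psi)=\mathrm{H}(x\xrightarrow{\varphi}y\xrightarrow{\psi}z)$ is the image of the composite $\ker(\psi)\hookrightarrow y\twoheadrightarrow\mathrm{coker}(\varphi)$, i.e. $(\ker(\psi)+\mathrm{im}(\varphi))/\mathrm{im}(\varphi)\simeq\ker(\psi)/(\mathrm{im}(\varphi)\cap\ker(\psi))$; it is functorial in morphisms of composable pairs. The morphism $\mathrm{H}(\epsilon)$ is the one induced by $(\delta,\epsilon,\zeta)$ from the pair $(\alpha,\beta)$ to the pair $(\theta,\iota)$. The morphism $\ker(\epsilon)\to\ker(\zeta)$ is induced by $\beta$. The morphism $\ker(\zeta)\to\mathrm{H}(\beta,\gamma)$ is the composite of the inclusion $\ker(\zeta)\hookrightarrow\ker(\gamma)$ (which exists since $\gamma\cdot\eta=\zeta\cdot\kappa$ and $\eta$ is a mono) with the canonical epimorphism $\ker(\gamma)\twoheadrightarrow\mathrm{H}(\beta,\gamma)$. *)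

theory Defs
  imports "HOL-Algebra.Group"
begin

section \<open>Categories\<close>

text \<open>Composition is written in diagrammatic order. All functions in the records are
  meaningful only on objects, morphisms and composable pairs.\<close>

record ('o, 'm) category_data =
  Ob :: "'o set"
  Ar :: "'m set"
  Dom :: "'m \<Rightarrow> 'o"
  Cod :: "'m \<Rightarrow> 'o"
  Ide :: "'o \<Rightarrow> 'm"
  Cmp :: "'m \<Rightarrow> 'm \<Rightarrow> 'm"  (infixl \<open>\<cdot>\<index>\<close> 70)

definition Hom :: "('o, 'm, 'r) category_data_scheme \<Rightarrow> 'o \<Rightarrow> 'o \<Rightarrow> 'm set" where
  "Hom C x y = {f \<in> Ar C. Dom C f = x \<and> Cod C f = y}"

locale category =
  fixes C :: "('o, 'm, 'r) category_data_scheme" (structure)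
  assumes Dom_closed: "f \<in> Ar C \<Longrightarrow> Dom C f \<in> Ob C"
    and Cod_closed: "f \<in> Ar C \<Longrightarrow> Cod C f \<in> Ob C"
    and Ide_closed: "x \<in> Ob C \<Longrightarrow> Ide C x \<in> Hom C x x"
    and Cmp_closed: "\<lbrakk>f \<in> Hom C x y; g \<in> Hom C y z\<rbrakk> \<Longrightarrow> f \<cdot> g \<in> Hom C x z"
    and Ide_left: "f \<in> Hom C x y \<Longrightarrow> Ide C x \<cdot> f = f"
    and Ide_right: "f \<in> Hom C x y \<Longrightarrow> f \<cdot> Ide C y = f"
    and Cmp_assoc: "\<lbrakk>f \<in> Hom C w x; g \<in> Hom C x y; h \<in> Hom C y z\<rbrakk>
      \<Longrightarrow> (f \<cdot> g) \<cdot> h = f \<cdot> (g \<cdot> h)"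

definition is_mono :: "('o, 'm, 'r) category_data_scheme \<Rightarrow> 'm \<Rightarrow> bool" where
  "is_mono C f \<longleftrightarrow> f \<in> Ar C \<and>
    (\<forall>x. \<forall>g \<in> Hom C x (Dom C f). \<forall>h \<in> Hom C x (Dom C f).
      g \<cdot>\<^bsub>C\<^esub> f = h \<cdot>\<^bsub>C\<^esub> f \<longrightarrow> g = h)"

definition is_epi :: "('o, 'm, 'r) category_data_scheme \<Rightarrow> 'm \<Rightarrow> bool" where
  "is_epi C f \<longleftrightarrow> f \<in> Ar C \<and>
    (\<forall>x. \<forall>g \<in> Hom C (Cod C f) x. \<forall>h \<in> Hom C (Cod C f) x.
      f \<cdot>\<^bsub>C\<^esub> g = f \<cdot>\<^bsub>C\<^esub> h \<longrightarrow> g = h)"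

definition is_iso :: "('o, 'm, 'r) category_data_scheme \<Rightarrow> 'm \<Rightarrow> bool" where
  "is_iso C f \<longleftrightarrow> f \<in> Ar C \<and>
    (\<exists>g \<in> Hom C (Cod C f) (Dom C f).
      f \<cdot>\<^bsub>C\<^esub> g = Ide C (Dom C f) \<and> g \<cdot>\<^bsub>C\<^esub> f = Ide C (Cod C f))"

definition zero_object :: "('o, 'm, 'r) category_data_scheme \<Rightarrow> 'o \<Rightarrow> bool" where
  "zero_object C z \<longleftrightarrow> z \<in> Ob C \<and>
    (\<forall>x \<in> Ob C. (\<exists>!f. f \<in> Hom C z x) \<and> (\<exists>!f. f \<in> Hom C x z))"

definition factor_right :: "('o, 'm, 'r) category_data_scheme \<Rightarrow> 'm \<Rightarrow> 'm \<Rightarrow> 'm" where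
  \<comment> \<open>the factorization of \<open>f\<close> over a monomorphism \<open>m\<close> with the same codomain; junk if there is none\<close>
  "factor_right C m f = (THE u. u \<in> Hom C (Dom C f) (Dom C m) \<and> u \<cdot>\<^bsub>C\<^esub> m = f)"

definition factor_left :: "('o, 'm, 'r) category_data_scheme \<Rightarrow> 'm \<Rightarrow> 'm \<Rightarrow> 'm" where
  \<comment> \<open>the factorization of \<open>f\<close> over an epimorphism \<open>e\<close> with the same domain; junk if there is none\<close>
  "factor_left C e f = (THE u. u \<in> Hom C (Cod C e) (Cod C f) \<and> e \<cdot>\<^bsub>C\<^esub> u = f)"


section \<open>Abelian categories\<close>

record ('o, 'm) preadditive_data = "('o, 'm) category_data" +
  Add :: "'m \<Rightarrow> 'm \<Rightarrow> 'm"  (infixl \<open>\<boxplus>\<index>\<close> 65)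
  Zer :: "'o \<Rightarrow> 'o \<Rightarrow> 'm"

locale preadditive_category = category C
  for C :: "('o, 'm, 'r) preadditive_data_scheme" (structure) +
  assumes Hom_comm_group: "\<lbrakk>x \<in> Ob C; y \<in> Ob C\<rbrakk>
      \<Longrightarrow> comm_group \<lparr>carrier = Hom C x y, mult = Add C, one = Zer C x y\<rparr>"
    and Cmp_Add_left: "\<lbrakk>f \<in> Hom C x y; f' \<in> Hom C x y; g \<in> Hom C y z\<rbrakk>
      \<Longrightarrow> (f \<boxplus> f') \<cdot> g = (f \<cdot> g) \<boxplus> (f' \<cdot> g)"
    and Cmp_Add_right: "\<lbrakk>f \<in> Hom C x y; g \<in> Hom C y z; g' \<in> Hom C y z\<rbrakk>
      \<Longrightarrow> f \<cdot> (g \<boxplus> g') = (f \<cdot> g) \<boxplus> (f \<cdot> g')"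

locale additive_category = preadditive_category +
  assumes zero_object_exists: "\<exists>z. zero_object C z"
    and biproduct_exists: "\<lbrakk>x \<in> Ob C; y \<in> Ob C\<rbrakk> \<Longrightarrow>
      \<exists>s i j p q. i \<in> Hom C x s \<and> j \<in> Hom C y s \<and> p \<in> Hom C s x \<and> q \<in> Hom C s y \<and>
        i \<cdot> p = Ide C x \<and> j \<cdot> q = Ide C y \<and> i \<cdot> q = Zer C x y \<and> j \<cdot> p = Zer C y x \<and>
        (p \<cdot> i) \<boxplus> (q \<cdot> j) = Ide C s"

definition is_kernel :: "('o, 'm, 'r) preadditive_data_scheme \<Rightarrow> 'm \<Rightarrow> 'm \<Rightarrow> bool" where
  "is_kernel C k f \<longleftrightarrow> k \<in> Ar C \<and> f \<in> Ar C \<and> Cod C k = Dom C f \<and>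
    k \<cdot>\<^bsub>C\<^esub> f = Zer C (Dom C k) (Cod C f) \<and>
    (\<forall>x. \<forall>g \<in> Hom C x (Dom C f). g \<cdot>\<^bsub>C\<^esub> f = Zer C x (Cod C f) \<longrightarrow>
      (\<exists>!u. u \<in> Hom C x (Dom C k) \<and> u \<cdot>\<^bsub>C\<^esub> k = g))"

definition is_cokernel :: "('o, 'm, 'r) preadditive_data_scheme \<Rightarrow> 'm \<Rightarrow> 'm \<Rightarrow> bool" where
  "is_cokernel C c f \<longleftrightarrow> c \<in> Ar C \<and> f \<in> Ar C \<and> Dom C c = Cod C f \<and>
    f \<cdot>\<^bsub>C\<^esub> c = Zer C (Dom C f) (Cod C c) \<and>
    (\<forall>x. \<forall>g \<in> Hom C (Cod C f) x. f \<cdot>\<^bsub>C\<^esub> g = Zer C (Dom C f) x \<longrightarrow>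
      (\<exists>!u. u \<in> Hom C (Cod C c) x \<and> c \<cdot>\<^bsub>C\<^esub> u = g))"

locale abelian_category = additive_category +
  assumes kernel_exists: "f \<in> Ar C \<Longrightarrow> \<exists>k. is_kernel C k f"
    and cokernel_exists: "f \<in> Ar C \<Longrightarrow> \<exists>c. is_cokernel C c f"
    and mono_normal: "is_mono C f \<Longrightarrow> \<exists>g. is_kernel C f g"
    and epi_normal: "is_epi C f \<Longrightarrow> \<exists>g. is_cokernel C f g"


section \<open>Kernels, cokernels, images\<close>

text \<open>Kernels and cokernels are determined only up to isomorphism; an arbitrary choice is
  fixed. Lower case denotes the morphism, upper case the object.\<close>

definition ker :: "('o, 'm, 'r) preadditive_data_scheme \<Rightarrow> 'm \<Rightarrow> 'm" where
  "ker C f = (SOME k. is_kernel C k f)"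

definition coker :: "('o, 'm, 'r) preadditive_data_scheme \<Rightarrow> 'm \<Rightarrow> 'm" where
  "coker C f = (SOME c. is_cokernel C c f)"

definition im :: "('o, 'm, 'r) preadditive_data_scheme \<Rightarrow> 'm \<Rightarrow> 'm" where
  "im C f = ker C (coker C f)"

definition Ker :: "('o, 'm, 'r) preadditive_data_scheme \<Rightarrow> 'm \<Rightarrow> 'o" where
  "Ker C f = Dom C (ker C f)"

definition Coker :: "('o, 'm, 'r) preadditive_data_scheme \<Rightarrow> 'm \<Rightarrow> 'o" where
  "Coker C f = Cod C (coker C f)"

definition Ker_map :: "('o, 'm, 'r) preadditive_data_scheme \<Rightarrow> 'm \<Rightarrow> 'm \<Rightarrow> 'm \<Rightarrow> 'm" where
  \<comment> \<open>the morphism \<open>Ker f \<rightarrow> Ker g\<close> induced by \<open>u : Dom f \<rightarrow> Dom g\<close>\<close>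
  "Ker_map C f g u = factor_right C (ker C g) (ker C f \<cdot>\<^bsub>C\<^esub> u)"

definition Coker_map :: "('o, 'm, 'r) preadditive_data_scheme \<Rightarrow> 'm \<Rightarrow> 'm \<Rightarrow> 'm \<Rightarrow> 'm" where
  \<comment> \<open>the morphism \<open>Coker f \<rightarrow> Coker g\<close> induced by \<open>v : Cod f \<rightarrow> Cod g\<close>\<close>
  "Coker_map C f g v = factor_left C (coker C f) (v \<cdot>\<^bsub>C\<^esub> coker C g)"

definition exact :: "('o, 'm, 'r) preadditive_data_scheme \<Rightarrow> 'm \<Rightarrow> 'm \<Rightarrow> bool" where
  "exact C f g \<longleftrightarrow> is_kernel C (im C f) g"


section \<open>Homology of a composable pair\<close>

text \<open>The composite of \<open>f\<close> and \<open>g\<close> is not required to vanish.\<close>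

definition H_mono :: "('o, 'm, 'r) preadditive_data_scheme \<Rightarrow> 'm \<Rightarrow> 'm \<Rightarrow> 'm" where
  \<comment> \<open>the canonical monomorphism from the homology into \<open>Coker f\<close>\<close>
  "H_mono C f g = im C (ker C g \<cdot>\<^bsub>C\<^esub> coker C f)"

definition H :: "('o, 'm, 'r) preadditive_data_scheme \<Rightarrow> 'm \<Rightarrow> 'm \<Rightarrow> 'o" where
  "H C f g = Dom C (H_mono C f g)"

definition H_epi :: "('o, 'm, 'r) preadditive_data_scheme \<Rightarrow> 'm \<Rightarrow> 'm \<Rightarrow> 'm" where
  \<comment> \<open>the canonical epimorphism from \<open>Ker g\<close> onto the homology\<close>
  "H_epi C f g = factor_right C (H_mono C f g) (ker C g \<cdot>\<^bsub>C\<^esub> coker C f)"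

text \<open>A morphism \<open>(u, v, w)\<close> of composable pairs from \<open>(f, g)\<close> to \<open>(f', g')\<close> induces a morphism
  on homology. It depends only on the middle component \<open>v\<close>; the existence of \<open>u\<close> and \<open>w\<close> is
  what makes it exist.\<close>

definition H_map ::
    "('o, 'm, 'r) preadditive_data_scheme \<Rightarrow> 'm \<Rightarrow> 'm \<Rightarrow> 'm \<Rightarrow> 'm \<Rightarrow> 'm \<Rightarrow> 'm" where
  "H_map C f g f' g' v = (THE t. t \<in> Hom C (H C f g) (H C f' g') \<and>
    H_epi C f g \<cdot>\<^bsub>C\<^esub> t = Ker_map C g g' v \<cdot>\<^bsub>C\<^esub> H_epi C f' g' \<and>
    t \<cdot>\<^bsub>C\<^esub> H_mono C f' g' = H_mono C f g \<cdot>\<^bsub>C\<^esub> Coker_map C f f' v)"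


section \<open>Filtrations and subquotients\<close>

definition filtration ::
    "('o, 'm, 'r) preadditive_data_scheme \<Rightarrow> 'o \<Rightarrow> nat \<Rightarrow> (nat \<Rightarrow> 'm) \<Rightarrow> bool" where
  \<comment> \<open>\<open>F 0, \<dots>, F n\<close> represent an ascending chain of subobjects from \<open>0\<close> to \<open>x\<close>\<close>
  "filtration C x n F \<longleftrightarrow>
    (\<forall>i \<le> n. is_mono C (F i) \<and> Cod C (F i) = x) \<and>
    (\<forall>i < n. \<exists>u \<in> Hom C (Dom C (F i)) (Dom C (F (Suc i))). u \<cdot>\<^bsub>C\<^esub> F (Suc i) = F i) \<and>
    zero_object C (Dom C (F 0)) \<and> is_iso C (F n)"

definition graded_part ::
    "('o, 'm, 'r) preadditive_data_scheme \<Rightarrow> (nat \<Rightarrow> 'm) \<Rightarrow> nat \<Rightarrow> 'o" where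
  \<comment> \<open>the quotient of the subobject \<open>F (Suc i)\<close> by the subobject \<open>F i\<close>\<close>
  "graded_part C F i = Coker C (factor_right C (F (Suc i)) (F i))"

definition subquotient :: "('o, 'm, 'r) category_data_scheme \<Rightarrow> 'o \<Rightarrow> 'o \<Rightarrow> bool" where
  \<comment> \<open>\<open>q\<close> is isomorphic to a quotient of a subobject of \<open>y\<close>\<close>
  "subquotient C q y \<longleftrightarrow>
    (\<exists>m e. is_mono C m \<and> Cod C m = y \<and> is_epi C e \<and> Dom C e = Dom C m \<and> Cod C e = q)"

end

theory Submission
  imports Defs
begin

text \<open>In a category of modules the monomorphism is a diagram chase. A class in the homology of
  \<open>Ker \<epsilon> \<rightarrow> Ker \<zeta> \<rightarrow> H(\<beta>, \<gamma>)\<close> is represented by some \<open>\<beta>(y)\<close> with \<open>\<zeta>(\<beta>(y)) = 0\<close>; then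
  \<open>\<iota>(\<epsilon>(y)) = 0\<close>, and the class is sent to that of \<open>\<epsilon>(y)\<close> in \<open>H(\<theta>, \<iota>)\<close> modulo the image of
  \<open>H(\<alpha>, \<beta>)\<close>. All choices are parametrised by the single object \<open>K = Ker (\<beta> \<cdot> \<zeta>)\<close>: it has an
  epimorphism onto the source of the desired monomorphism (\<open>y \<mapsto> [\<beta>(y)]\<close>, see \<open>left_epi\<close>) and a
  morphism to its target (\<open>y \<mapsto> [\<epsilon>(y)]\<close>). So the whole claim is that these two morphisms have the
  same kernel (\<open>mono_if_same_points\<close>). Both kernels consist of the \<open>y\<close> for which \<open>\<beta>(y) = \<beta>(n)\<close> for
  some \<open>n\<close> in the kernel of \<open>\<epsilon>\<close> (\<open>image_from_ker_iff_left\<close>, \<open>image_from_ker_iff_right\<close>): if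
  \<open>\<epsilon>(y) = \<theta>(z) + \<epsilon>(x)\<close> with \<open>\<beta>(x) = 0\<close>, then surjectivity of \<open>\<delta>\<close> gives \<open>z = \<delta>(u)\<close>, whence
  \<open>n = y - x - \<alpha>(u)\<close> is killed by \<open>\<epsilon>\<close> and has the same image as \<open>y\<close> under \<open>\<beta>\<close>.

  In an arbitrary abelian category, elements of \<open>b\<close> become points, that is, morphisms \<open>T \<rightarrow> b\<close>, and
  the step "choose a preimage" becomes "choose a preimage after composing with an epimorphism
  \<open>T' \<rightarrow> T\<close>". This is the content of \<open>epi_refine\<close> (epimorphisms) and \<open>coker_refine\<close> (images).
  Since epimorphisms can be cancelled, equations between points that hold after such a refinement
  hold already.

  The filtration of \<open>Ker \<zeta>\<close> is \<open>0 \<subseteq> im (Ker \<epsilon> \<rightarrow> Ker \<zeta>) \<subseteq> Ker (Ker \<zeta> \<rightarrow> H(\<beta>, \<gamma>)) \<subseteq> Ker \<zeta>\<close>.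
  Its middle quotient is the homology just described, up to isomorphism, which explains why it is a
  subquotient of \<open>H(\<theta>, \<iota>)\<close>. When the three objects vanish, the same chase leaves nothing in \<open>Ker \<zeta>\<close>.\<close>

section \<open>Categories and preadditive categories\<close>

text \<open>Membership in a hom-set is decomposed into its three components throughout, so that the
  simplifier can discharge composability conditions without guessing intermediate objects.\<close>

lemma Hom_iff: "f \<in> Hom C x y \<longleftrightarrow> f \<in> Ar C \<and> Dom C f = x \<and> Cod C f = y"
  by (simp add: Hom_def)

context category
begin

declare Dom_closed [simp] Cod_closed [simp]

lemma Ide_arrow [simp]:
  assumes "x \<in> Ob C"
  shows "Ide C x \<in> Ar C" "Dom C (Ide C x) = x" "Cod C (Ide C x) = x"
  using Ide_closed[OF assms] by (auto simp: Hom_iff)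

lemma Cmp_arrow [simp]:
  assumes "f \<in> Ar C" "g \<in> Ar C" "Cod C f = Dom C g"
  shows "f \<cdot> g \<in> Ar C" "Dom C (f \<cdot> g) = Dom C f" "Cod C (f \<cdot> g) = Cod C g"
  using Cmp_closed[of f "Dom C f" "Cod C f" g "Cod C g"] assms by (auto simp: Hom_iff)

lemma Cmp_assoc' [simp]:
  assumes "f \<in> Ar C" "g \<in> Ar C" "h \<in> Ar C" "Cod C f = Dom C g" "Cod C g = Dom C h"
  shows "(f \<cdot> g) \<cdot> h = f \<cdot> (g \<cdot> h)"
  using assms by (intro Cmp_assoc) (auto simp: Hom_iff)

lemma Ide_Cmp [simp]: "\<lbrakk>f \<in> Ar C; Dom C f = x\<rbrakk> \<Longrightarrow> Ide C x \<cdot> f = f"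
  and Cmp_Ide [simp]: "\<lbrakk>f \<in> Ar C; Cod C f = y\<rbrakk> \<Longrightarrow> f \<cdot> Ide C y = f"
  using Ide_left Ide_right by (auto simp: Hom_iff)

text \<open>Composites are normalised by association to the right. This hides a factorisation \<open>f \<cdot> g = r\<close>
  inside longer composites; the following form applies there.\<close>

lemma Cmp_assoc_eq:
  assumes "f \<cdot> g = r" "f \<in> Ar C" "g \<in> Ar C" "h \<in> Ar C" "Cod C f = Dom C g" "Cod C g = Dom C h"
  shows "f \<cdot> (g \<cdot> h) = r \<cdot> h"
  using assms Cmp_assoc' by metis

lemma mono_arrow: "is_mono C m \<Longrightarrow> m \<in> Ar C"
  and epi_arrow: "is_epi C e \<Longrightarrow> e \<in> Ar C"
  by (auto simp: is_mono_def is_epi_def)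

lemma mono_cancel:
  assumes "is_mono C m" "x \<cdot> m = y \<cdot> m" "x \<in> Ar C" "y \<in> Ar C"
    "Dom C x = Dom C y" "Cod C x = Dom C m" "Cod C y = Dom C m"
  shows "x = y"
  using assms unfolding is_mono_def by (auto simp: Hom_iff)

lemma epi_cancel:
  assumes "is_epi C e" "e \<cdot> x = e \<cdot> y" "x \<in> Ar C" "y \<in> Ar C"
    "Cod C x = Cod C y" "Dom C x = Cod C e" "Dom C y = Cod C e"
  shows "x = y"
  using assms unfolding is_epi_def by (auto simp: Hom_iff)

lemma Ide_mono: "x \<in> Ob C \<Longrightarrow> is_mono C (Ide C x)"
  by (auto simp: is_mono_def Hom_iff)

lemma Ide_iso: "x \<in> Ob C \<Longrightarrow> is_iso C (Ide C x)"
  unfolding is_iso_def by (auto simp: Hom_iff intro!: bexI[of _ "Ide C x"])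

lemma mono_Cmp:
  assumes "is_mono C m" "is_mono C n" "Cod C m = Dom C n"
  shows "is_mono C (m \<cdot> n)"
proof -
  note [simp] = mono_arrow[OF assms(1)] mono_arrow[OF assms(2)] assms(3)
  show ?thesis
    unfolding is_mono_def
  proof (intro conjI allI ballI impI)
    fix t x y
    assume xy: "x \<in> Hom C t (Dom C (m \<cdot> n))" "y \<in> Hom C t (Dom C (m \<cdot> n))"
      "x \<cdot> (m \<cdot> n) = y \<cdot> (m \<cdot> n)"
    have "x \<cdot> m = y \<cdot> m"
      by (rule mono_cancel[OF assms(2)]) (use xy in \<open>auto simp: Hom_iff\<close>)
    then show "x = y"
      by (rule mono_cancel[OF assms(1)]) (use xy in \<open>auto simp: Hom_iff\<close>)
  qed simp
qed

lemma epi_Cmp: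
  assumes "is_epi C d" "is_epi C e" "Cod C d = Dom C e"
  shows "is_epi C (d \<cdot> e)"
proof -
  note [simp] = epi_arrow[OF assms(1)] epi_arrow[OF assms(2)] assms(3)
  show ?thesis
    unfolding is_epi_def
  proof (intro conjI allI ballI impI)
    fix t x y
    assume xy: "x \<in> Hom C (Cod C (d \<cdot> e)) t" "y \<in> Hom C (Cod C (d \<cdot> e)) t"
      "d \<cdot> e \<cdot> x = d \<cdot> e \<cdot> y"
    have "e \<cdot> x = e \<cdot> y"
      by (rule epi_cancel[OF assms(1)]) (use xy in \<open>auto simp: Hom_iff\<close>)
    then show "x = y"
      by (rule epi_cancel[OF assms(2)]) (use xy in \<open>auto simp: Hom_iff\<close>)
  qed simp
qed

lemma epi_right_factor:
  assumes "is_epi C (f \<cdot> g)" "f \<in> Ar C" "g \<in> Ar C" "Cod C f = Dom C g"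
  shows "is_epi C g"
  unfolding is_epi_def
proof (intro conjI allI ballI impI)
  fix t x y
  assume xy: "x \<in> Hom C (Cod C g) t" "y \<in> Hom C (Cod C g) t" "g \<cdot> x = g \<cdot> y"
  show "x = y"
    by (rule epi_cancel[OF assms(1)]) (use xy assms in \<open>auto simp: Hom_iff\<close>)
qed fact

lemma factor_right_eq:
  assumes "is_mono C m" "u \<in> Ar C" "Cod C u = Dom C m" "u \<cdot> m = x"
  shows "factor_right C m x = u"
proof -
  have "m \<in> Ar C" using assms(1) by (rule mono_arrow)
  then show ?thesis
    unfolding factor_right_def
    using assms by (intro the_equality) (auto simp: Hom_iff intro: mono_cancel[OF assms(1)])
qed

lemma factor_left_eq:
  assumes "is_epi C e" "u \<in> Ar C" "Dom C u = Cod C e" "e \<cdot> u = x"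
  shows "factor_left C e x = u"
proof -
  have "e \<in> Ar C" using assms(1) by (rule epi_arrow)
  then show ?thesis
    unfolding factor_left_def
    using assms by (intro the_equality) (auto simp: Hom_iff intro: epi_cancel[OF assms(1)])
qed

end

context preadditive_category
begin

abbreviation Hom_group where
  "Hom_group x y \<equiv> \<lparr>carrier = Hom C x y, mult = Add C, one = Zer C x y\<rparr>"

text \<open>Subtraction is what turns the test for equality of two morphisms into a test for vanishing.
  It is characterised by \<open>diff_Add\<close> and cancellation, without reference to negatives.\<close>

definition diff (infixl \<open>\<boxminus>\<close> 65) where
  "f \<boxminus> g = f \<boxplus> inv\<^bsub>Hom_group (Dom C f) (Cod C f)\<^esub> g"

lemma diff_Hom: "\<lbrakk>f \<in> Hom C x y; g \<in> Hom C x y\<rbrakk> \<Longrightarrow> f \<boxminus> g \<in> Hom C x y"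
  and diff_Add: "\<lbrakk>f \<in> Hom C x y; g \<in> Hom C x y\<rbrakk> \<Longrightarrow> (f \<boxminus> g) \<boxplus> g = f"
proof -
  assume fg: "f \<in> Hom C x y" "g \<in> Hom C x y"
  then have "x \<in> Ob C" "y \<in> Ob C" by (auto simp: Hom_iff)
  then interpret G: comm_group "Hom_group x y" by (rule Hom_comm_group)
  have d: "f \<boxminus> g = f \<otimes>\<^bsub>Hom_group x y\<^esub> inv\<^bsub>Hom_group x y\<^esub> g"
    using fg by (simp add: diff_def Hom_iff)
  show "f \<boxminus> g \<in> Hom C x y"
    using fg G.m_closed[of f "inv\<^bsub>Hom_group x y\<^esub> g"] G.inv_closed[of g] unfolding d by simp
  show "(f \<boxminus> g) \<boxplus> g = f"
    using fg G.m_assoc[of f "inv\<^bsub>Hom_group x y\<^esub> g" g] G.inv_closed[of g] G.l_inv[of g] G.r_one[of f]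
    unfolding d by simp
qed

lemma Add_cancel:
  assumes "f \<boxplus> h = g \<boxplus> h" "f \<in> Hom C x y" "g \<in> Hom C x y" "h \<in> Hom C x y"
  shows "f = g"
proof -
  have "x \<in> Ob C" "y \<in> Ob C" using assms by (auto simp: Hom_iff)
  then interpret G: comm_group "Hom_group x y" by (rule Hom_comm_group)
  show ?thesis using assms G.right_cancel[of h f g] by simp
qed

lemma Zer_Hom: "\<lbrakk>x \<in> Ob C; y \<in> Ob C\<rbrakk> \<Longrightarrow> Zer C x y \<in> Hom C x y"
  using monoid.one_closed[of "Hom_group x y"] Hom_comm_group[of x y]
  by (auto simp: comm_group_def group_def)

lemma Zer_arrow [simp]:
  assumes "x \<in> Ob C" "y \<in> Ob C"
  shows "Zer C x y \<in> Ar C" "Dom C (Zer C x y) = x" "Cod C (Zer C x y) = y"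
  using Zer_Hom[OF assms] by (auto simp: Hom_iff)

lemma Zer_Add:
  assumes "f \<in> Hom C x y"
  shows "Zer C x y \<boxplus> f = f" "f \<boxplus> Zer C x y = f"
proof -
  have "x \<in> Ob C" "y \<in> Ob C" using assms by (auto simp: Hom_iff)
  then interpret G: comm_group "Hom_group x y" by (rule Hom_comm_group)
  show "Zer C x y \<boxplus> f = f" "f \<boxplus> Zer C x y = f"
    using assms G.l_one[of f] G.r_one[of f] by simp_all
qed

lemma diff_arrow [simp]:
  assumes "f \<in> Ar C" "g \<in> Ar C" "Dom C f = Dom C g" "Cod C f = Cod C g"
  shows "f \<boxminus> g \<in> Ar C" "Dom C (f \<boxminus> g) = Dom C g" "Cod C (f \<boxminus> g) = Cod C g"
  using diff_Hom[of f "Dom C g" "Cod C g" g] assms by (auto simp: Hom_iff)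

lemma diff_eq_Zer:
  assumes "f \<in> Ar C" "g \<in> Ar C" "Dom C f = Dom C g" "Cod C f = Cod C g"
  shows "f \<boxminus> g = Zer C (Dom C g) (Cod C g) \<longleftrightarrow> f = g"
proof
  have "(f \<boxminus> g) \<boxplus> g = f"
    using assms by (intro diff_Add) (auto simp: Hom_iff)
  moreover have "Zer C (Dom C g) (Cod C g) \<boxplus> g = g"
    using assms by (intro Zer_Add) (auto simp: Hom_iff)
  ultimately show "f \<boxminus> g = Zer C (Dom C g) (Cod C g) \<Longrightarrow> f = g" by simp
next
  assume "f = g"
  then show "f \<boxminus> g = Zer C (Dom C g) (Cod C g)"
    using assms diff_Add[of g "Dom C g" "Cod C g" g] Zer_Add(1)[of g "Dom C g" "Cod C g"]
    by (auto simp: Hom_iff intro: Add_cancel[of _ g _ "Dom C g" "Cod C g"])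
qed

lemma diff_Zer:
  assumes "f \<in> Ar C" "Dom C f = x" "Cod C f = y"
  shows "f \<boxminus> Zer C x y = f"
proof -
  have Hf: "f \<in> Hom C x y" using assms by (simp add: Hom_iff)
  have Z: "Zer C x y \<in> Hom C x y" using assms by (intro Zer_Hom) auto
  show ?thesis
    using diff_Add[OF Hf Z] Zer_Add(2)[OF diff_Hom[OF Hf Z]] by simp
qed

lemma Cmp_diff_left:
  assumes "f \<in> Ar C" "g \<in> Ar C" "h \<in> Ar C" "Dom C f = Dom C g" "Cod C f = Cod C g" "Cod C g = Dom C h"
  shows "(f \<boxminus> g) \<cdot> h = f \<cdot> h \<boxminus> g \<cdot> h"
proof (rule Add_cancel)
  have "((f \<boxminus> g) \<cdot> h) \<boxplus> (g \<cdot> h) = ((f \<boxminus> g) \<boxplus> g) \<cdot> h"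
    using assms by (intro Cmp_Add_left[symmetric]) (auto simp: Hom_iff)
  also have "\<dots> = f \<cdot> h"
    using assms diff_Add[of f "Dom C g" "Cod C g" g] by (simp add: Hom_iff)
  also have "\<dots> = (f \<cdot> h \<boxminus> g \<cdot> h) \<boxplus> (g \<cdot> h)"
    using assms by (intro diff_Add[symmetric]) (auto simp: Hom_iff)
  finally show "((f \<boxminus> g) \<cdot> h) \<boxplus> (g \<cdot> h) = (f \<cdot> h \<boxminus> g \<cdot> h) \<boxplus> (g \<cdot> h)" .
qed (use assms in \<open>auto simp: Hom_iff\<close>)

lemma Cmp_diff_right:
  assumes "f \<in> Ar C" "g \<in> Ar C" "h \<in> Ar C" "Dom C f = Dom C g" "Cod C f = Cod C g" "Cod C h = Dom C g"
  shows "h \<cdot> (f \<boxminus> g) = h \<cdot> f \<boxminus> h \<cdot> g"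
proof (rule Add_cancel)
  have "(h \<cdot> (f \<boxminus> g)) \<boxplus> (h \<cdot> g) = h \<cdot> ((f \<boxminus> g) \<boxplus> g)"
    using assms by (intro Cmp_Add_right[symmetric]) (auto simp: Hom_iff)
  also have "\<dots> = h \<cdot> f"
    using assms diff_Add[of f "Dom C g" "Cod C g" g] by (simp add: Hom_iff)
  also have "\<dots> = (h \<cdot> f \<boxminus> h \<cdot> g) \<boxplus> (h \<cdot> g)"
    using assms by (intro diff_Add[symmetric]) (auto simp: Hom_iff)
  finally show "(h \<cdot> (f \<boxminus> g)) \<boxplus> (h \<cdot> g) = (h \<cdot> f \<boxminus> h \<cdot> g) \<boxplus> (h \<cdot> g)" .
qed (use assms in \<open>auto simp: Hom_iff\<close>)

lemma Zer_Cmp [simp]: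
  assumes "x \<in> Ob C" "f \<in> Ar C" "Dom C f = y"
  shows "Zer C x y \<cdot> f = Zer C x (Cod C f)"
proof (rule Add_cancel)
  have "(Zer C x y \<boxplus> Zer C x y) \<cdot> f = (Zer C x y \<cdot> f) \<boxplus> (Zer C x y \<cdot> f)"
    using assms by (intro Cmp_Add_left) (auto simp: Hom_iff)
  moreover have "Zer C x y \<boxplus> Zer C x y = Zer C x y"
    using assms by (intro Zer_Add) (auto simp: Hom_iff)
  moreover have "Zer C x (Cod C f) \<boxplus> (Zer C x y \<cdot> f) = Zer C x y \<cdot> f"
    using assms by (intro Zer_Add) (auto simp: Hom_iff)
  ultimately show "(Zer C x y \<cdot> f) \<boxplus> (Zer C x y \<cdot> f) = Zer C x (Cod C f) \<boxplus> (Zer C x y \<cdot> f)"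
    by simp
qed (use assms in \<open>auto simp: Hom_iff\<close>)

lemma Cmp_Zer [simp]:
  assumes "z \<in> Ob C" "f \<in> Ar C" "Cod C f = y"
  shows "f \<cdot> Zer C y z = Zer C (Dom C f) z"
proof (rule Add_cancel)
  have "f \<cdot> (Zer C y z \<boxplus> Zer C y z) = (f \<cdot> Zer C y z) \<boxplus> (f \<cdot> Zer C y z)"
    using assms by (intro Cmp_Add_right) (auto simp: Hom_iff)
  moreover have "Zer C y z \<boxplus> Zer C y z = Zer C y z"
    using assms by (intro Zer_Add) (auto simp: Hom_iff)
  moreover have "Zer C (Dom C f) z \<boxplus> (f \<cdot> Zer C y z) = f \<cdot> Zer C y z"
    using assms by (intro Zer_Add) (auto simp: Hom_iff)
  ultimately show "(f \<cdot> Zer C y z) \<boxplus> (f \<cdot> Zer C y z) = Zer C (Dom C f) z \<boxplus> (f \<cdot> Zer C y z)"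
    by simp
qed (use assms in \<open>auto simp: Hom_iff\<close>)

lemma mono_zeroI:
  assumes "m \<in> Ar C"
    and "\<And>x. \<lbrakk>x \<in> Ar C; Cod C x = Dom C m; x \<cdot> m = Zer C (Dom C x) (Cod C m)\<rbrakk>
      \<Longrightarrow> x = Zer C (Dom C x) (Dom C m)"
  shows "is_mono C m"
  unfolding is_mono_def
proof (intro conjI allI ballI impI)
  fix t x y
  assume xy: "x \<in> Hom C t (Dom C m)" "y \<in> Hom C t (Dom C m)" "x \<cdot> m = y \<cdot> m"
  then have "(x \<boxminus> y) \<cdot> m = Zer C t (Cod C m)"
    using assms(1) diff_eq_Zer[of "x \<cdot> m" "y \<cdot> m"] by (auto simp: Hom_iff Cmp_diff_left)
  then have "x \<boxminus> y = Zer C t (Dom C m)"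
    using assms(2)[of "x \<boxminus> y"] assms(1) xy by (auto simp: Hom_iff)
  then show "x = y" using diff_eq_Zer[of x y] xy by (auto simp: Hom_iff)
qed fact

lemma epi_zeroI:
  assumes "e \<in> Ar C"
    and "\<And>x. \<lbrakk>x \<in> Ar C; Dom C x = Cod C e; e \<cdot> x = Zer C (Dom C e) (Cod C x)\<rbrakk>
      \<Longrightarrow> x = Zer C (Cod C e) (Cod C x)"
  shows "is_epi C e"
  unfolding is_epi_def
proof (intro conjI allI ballI impI)
  fix t x y
  assume xy: "x \<in> Hom C (Cod C e) t" "y \<in> Hom C (Cod C e) t" "e \<cdot> x = e \<cdot> y"
  then have "e \<cdot> (x \<boxminus> y) = Zer C (Dom C e) t"
    using assms(1) diff_eq_Zer[of "e \<cdot> x" "e \<cdot> y"] by (auto simp: Hom_iff Cmp_diff_right)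
  then have "x \<boxminus> y = Zer C (Cod C e) t"
    using assms(2)[of "x \<boxminus> y"] assms(1) xy by (auto simp: Hom_iff)
  then show "x = y" using diff_eq_Zer[of x y] xy by (auto simp: Hom_iff)
qed fact

lemma mono_zero:
  assumes "is_mono C m" "x \<cdot> m = Zer C (Dom C x) (Cod C m)" "x \<in> Ar C" "Cod C x = Dom C m"
  shows "x = Zer C (Dom C x) (Dom C m)"
  by (rule mono_cancel[OF assms(1)]) (use assms mono_arrow[OF assms(1)] in auto)

lemma epi_zero:
  assumes "is_epi C e" "e \<cdot> x = Zer C (Dom C e) (Cod C x)" "x \<in> Ar C" "Dom C x = Cod C e"
  shows "x = Zer C (Cod C e) (Cod C x)"
  by (rule epi_cancel[OF assms(1)]) (use assms epi_arrow[OF assms(1)] in auto)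

text \<open>If the identity of \<open>x\<close> is the zero morphism, every morphism out of or into \<open>x\<close> is its own
  composite with that identity, hence zero.\<close>

lemma zero_object_iff: "zero_object C x \<longleftrightarrow> x \<in> Ob C \<and> Ide C x = Zer C x x"
proof safe
  assume z: "zero_object C x"
  then show x: "x \<in> Ob C" by (simp add: zero_object_def)
  then show "Ide C x = Zer C x x"
    using z Ide_closed[OF x] Zer_Hom[OF x x] unfolding zero_object_def by blast
next
  assume x: "x \<in> Ob C" "Ide C x = Zer C x x"
  have "f = Zer C x y" if "f \<in> Hom C x y" for f y
    using that x Ide_Cmp[of f x] by (auto simp: Hom_iff)
  moreover have "f = Zer C y x" if "f \<in> Hom C y x" for f y
    using that x Cmp_Ide[of f x] by (auto simp: Hom_iff)
  ultimately show "zero_object C x"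
    unfolding zero_object_def using x(1) Zer_Hom by blast
qed

lemma zero_object_Dom:
  assumes "zero_object C x" "f \<in> Ar C" "Dom C f = x"
  shows "f = Zer C x (Cod C f)"
  using assms Ide_Cmp[of f x] Zer_Cmp[of x f x] by (simp add: zero_object_iff)

lemma zero_object_Cod:
  assumes "zero_object C x" "f \<in> Ar C" "Cod C f = x"
  shows "f = Zer C (Dom C f) x"
  using assms Cmp_Ide[of f x] Cmp_Zer[of x f x] by (simp add: zero_object_iff)

lemma kernel_mono: "is_kernel C k f \<Longrightarrow> is_mono C k"
  unfolding is_mono_def
proof (intro conjI allI ballI impI)
  fix t x y
  assume k: "is_kernel C k f" and xy: "x \<in> Hom C t (Dom C k)" "y \<in> Hom C t (Dom C k)" "x \<cdot> k = y \<cdot> k"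
  have "x \<cdot> k \<in> Hom C t (Dom C f)" "(x \<cdot> k) \<cdot> f = Zer C t (Cod C f)"
    using k xy by (auto simp: is_kernel_def Hom_iff)
  then have "\<exists>!u. u \<in> Hom C t (Dom C k) \<and> u \<cdot> k = x \<cdot> k"
    using k unfolding is_kernel_def by blast
  then show "x = y" using xy by metis
qed (simp add: is_kernel_def)

lemma cokernel_epi: "is_cokernel C c f \<Longrightarrow> is_epi C c"
  unfolding is_epi_def
proof (intro conjI allI ballI impI)
  fix t x y
  assume c: "is_cokernel C c f" and xy: "x \<in> Hom C (Cod C c) t" "y \<in> Hom C (Cod C c) t" "c \<cdot> x = c \<cdot> y"
  have "c \<cdot> x \<in> Hom C (Cod C f) t" "f \<cdot> (c \<cdot> x) = Zer C (Dom C f) t"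
    using c xy by (auto simp: is_cokernel_def Hom_iff Cmp_assoc_eq[of f c "Zer C (Dom C f) (Cod C c)"])
  then have "\<exists>!u. u \<in> Hom C (Cod C c) t \<and> c \<cdot> u = c \<cdot> x"
    using c unfolding is_cokernel_def by blast
  then show "x = y" using xy by metis
qed (simp add: is_cokernel_def)

lemma kernel_lift:
  assumes "is_kernel C k f" "x \<in> Ar C" "Cod C x = Dom C f" "x \<cdot> f = Zer C (Dom C x) (Cod C f)"
  shows "\<exists>u. u \<in> Ar C \<and> Dom C u = Dom C x \<and> Cod C u = Dom C k \<and> u \<cdot> k = x"
proof -
  have "x \<in> Hom C (Dom C x) (Dom C f)" using assms by (simp add: Hom_iff)
  then have "\<exists>u. u \<in> Hom C (Dom C x) (Dom C k) \<and> u \<cdot> k = x"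
    using assms(1,4) unfolding is_kernel_def by blast
  then show ?thesis by (auto simp: Hom_iff)
qed

lemma cokernel_lift:
  assumes "is_cokernel C c f" "x \<in> Ar C" "Dom C x = Cod C f" "f \<cdot> x = Zer C (Dom C f) (Cod C x)"
  shows "\<exists>u. u \<in> Ar C \<and> Dom C u = Cod C c \<and> Cod C u = Cod C x \<and> c \<cdot> u = x"
proof -
  have "x \<in> Hom C (Cod C f) (Cod C x)" using assms by (simp add: Hom_iff)
  then have "\<exists>u. u \<in> Hom C (Cod C c) (Cod C x) \<and> c \<cdot> u = x"
    using assms(1,4) unfolding is_cokernel_def by blast
  then show ?thesis by (auto simp: Hom_iff)
qed

end

section \<open>Points and their refinements in abelian categories\<close>

context abelian_category
begin

lemma ker_is_kernel: "f \<in> Ar C \<Longrightarrow> is_kernel C (ker C f) f"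
  unfolding ker_def by (rule someI_ex) (rule kernel_exists)

lemma coker_is_cokernel: "f \<in> Ar C \<Longrightarrow> is_cokernel C (coker C f) f"
  unfolding coker_def by (rule someI_ex) (rule cokernel_exists)

lemma ker_arrow [simp]:
  assumes "f \<in> Ar C"
  shows "ker C f \<in> Ar C" "Dom C (ker C f) = Ker C f" "Cod C (ker C f) = Dom C f"
    "ker C f \<cdot> f = Zer C (Ker C f) (Cod C f)" "is_mono C (ker C f)" "Ker C f \<in> Ob C"
  using ker_is_kernel[OF assms] kernel_mono[OF ker_is_kernel[OF assms]]
  by (auto simp: is_kernel_def Ker_def)

lemma coker_arrow [simp]:
  assumes "f \<in> Ar C"
  shows "coker C f \<in> Ar C" "Dom C (coker C f) = Cod C f" "Cod C (coker C f) = Coker C f"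
    "f \<cdot> coker C f = Zer C (Dom C f) (Coker C f)" "is_epi C (coker C f)" "Coker C f \<in> Ob C"
  using coker_is_cokernel[OF assms] cokernel_epi[OF coker_is_cokernel[OF assms]]
  by (auto simp: is_cokernel_def Coker_def)

lemma ker_lift:
  assumes "f \<in> Ar C" "x \<in> Ar C" "Cod C x = Dom C f" "x \<cdot> f = Zer C (Dom C x) (Cod C f)"
  obtains u where "u \<in> Ar C" "Dom C u = Dom C x" "Cod C u = Ker C f" "u \<cdot> ker C f = x"
  using kernel_lift[OF ker_is_kernel assms(2-4)] assms(1) by auto

lemma coker_lift:
  assumes "f \<in> Ar C" "x \<in> Ar C" "Dom C x = Cod C f" "f \<cdot> x = Zer C (Dom C f) (Cod C x)"
  obtains u where "u \<in> Ar C" "Dom C u = Coker C f" "Cod C u = Cod C x" "coker C f \<cdot> u = x"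
  using cokernel_lift[OF coker_is_cokernel assms(2-4)] assms(1) by auto

text \<open>A monomorphism is the kernel of some morphism, and that morphism factors through the cokernel;
  so a monomorphism is the kernel of its cokernel.\<close>

lemma mono_lift:
  assumes "is_mono C m" "x \<in> Ar C" "Cod C x = Cod C m" "x \<cdot> coker C m = Zer C (Dom C x) (Coker C m)"
  obtains u where "u \<in> Ar C" "Dom C u = Dom C x" "Cod C u = Dom C m" "u \<cdot> m = x"
proof -
  note m [simp] = mono_arrow[OF assms(1)]
  obtain g where k: "is_kernel C m g" using mono_normal[OF assms(1)] by blast
  then have g [simp]: "g \<in> Ar C" "Dom C g = Cod C m" and mg: "m \<cdot> g = Zer C (Dom C m) (Cod C g)"
    by (auto simp: is_kernel_def)
  obtain g' where g': "g' \<in> Ar C" "Dom C g' = Coker C m" "Cod C g' = Cod C g" "coker C m \<cdot> g' = g"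
    using coker_lift[OF m g mg] by blast
  have "x \<cdot> g = (x \<cdot> coker C m) \<cdot> g'"
    using g' assms(2,3) by simp
  also have "\<dots> = Zer C (Dom C x) (Cod C g)"
    using g' assms(2,3) by (simp only: assms(4)) simp
  finally show thesis
    using kernel_lift[OF k assms(2)] assms(3) that by auto
qed

lemma epi_lift:
  assumes "is_epi C e" "x \<in> Ar C" "Dom C x = Dom C e" "ker C e \<cdot> x = Zer C (Ker C e) (Cod C x)"
  obtains u where "u \<in> Ar C" "Dom C u = Cod C e" "Cod C u = Cod C x" "e \<cdot> u = x"
proof -
  note e [simp] = epi_arrow[OF assms(1)]
  obtain g where k: "is_cokernel C e g" using epi_normal[OF assms(1)] by blast
  then have g [simp]: "g \<in> Ar C" "Cod C g = Dom C e" and ge: "g \<cdot> e = Zer C (Dom C g) (Cod C e)"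
    by (auto simp: is_cokernel_def)
  obtain g' where g': "g' \<in> Ar C" "Dom C g' = Dom C g" "Cod C g' = Ker C e" "g' \<cdot> ker C e = g"
    using ker_lift[OF e g ge] by blast
  have "g \<cdot> x = g' \<cdot> (ker C e \<cdot> x)"
    using g' assms(2,3) Cmp_assoc'[of g' "ker C e" x] by simp
  also have "\<dots> = Zer C (Dom C g) (Cod C x)"
    using g' assms(2,3) by (simp only: assms(4)) simp
  finally show thesis
    using cokernel_lift[OF k assms(2)] assms(3) that by auto
qed

lemma im_arrow [simp]:
  assumes "f \<in> Ar C"
  shows "im C f \<in> Ar C" "Cod C (im C f) = Cod C f" "is_mono C (im C f)"
    "im C f \<cdot> coker C f = Zer C (Dom C (im C f)) (Coker C f)"
  using assms by (auto simp: im_def)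

lemma im_lift:
  assumes "f \<in> Ar C" "x \<in> Ar C" "Cod C x = Cod C f" "x \<cdot> coker C f = Zer C (Dom C x) (Coker C f)"
  obtains u where "u \<in> Ar C" "Dom C u = Dom C x" "Cod C u = Dom C (im C f)" "u \<cdot> im C f = x"
  using ker_lift[of "coker C f" x] assms by (auto simp: im_def)

text \<open>The image is the smallest subobject through which \<open>f\<close> factors. If the corestriction killed
  something, \<open>f\<close> would factor through a smaller one.\<close>

lemma image_factorization:
  assumes f [simp]: "f \<in> Ar C"
  obtains u where "is_epi C u" "Dom C u = Dom C f" "Cod C u = Dom C (im C f)" "u \<cdot> im C f = f"
proof -
  obtain u where u [simp]: "u \<in> Ar C" "Dom C u = Dom C f" "Cod C u = Dom C (im C f)" "u \<cdot> im C f = f"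
    using im_lift[of f f] by auto
  have "is_epi C u"
  proof (rule epi_zeroI)
    fix x assume x [simp]: "x \<in> Ar C" "Dom C x = Cod C u" and ux: "u \<cdot> x = Zer C (Dom C u) (Cod C x)"
    \<comment> \<open>\<open>f\<close> factors through the subobject \<open>?m\<close> of its image; comparing cokernels shows that \<open>?m\<close> is
      the whole image, so \<open>?k\<close> is a split epimorphism and \<open>x\<close> vanishes\<close>
    let ?k = "ker C x"
    obtain v where v [simp]: "v \<in> Ar C" "Dom C v = Dom C u" "Cod C v = Ker C x" "v \<cdot> ?k = u"
      using ker_lift[of x u] ux by auto
    let ?m = "?k \<cdot> im C f"
    have m: "is_mono C ?m" by (intro mono_Cmp) auto
    have "f = v \<cdot> ?m" using Cmp_assoc'[of v ?k "im C f"] by simp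
    then have "f \<cdot> coker C ?m = v \<cdot> (?m \<cdot> coker C ?m)"
      using Cmp_assoc'[of v ?m "coker C ?m"] by simp
    also have "\<dots> = Zer C (Dom C f) (Coker C ?m)"
      by (subst coker_arrow(4)) auto
    finally obtain c where c [simp]: "c \<in> Ar C" "Dom C c = Coker C f" "Cod C c = Coker C ?m"
      "coker C f \<cdot> c = coker C ?m"
      using coker_lift[of f "coker C ?m"] by auto
    have "im C f \<cdot> coker C ?m = (im C f \<cdot> coker C f) \<cdot> c"
      using Cmp_assoc'[of "im C f" "coker C f" c] by simp
    also have "\<dots> = Zer C (Dom C (im C f)) (Coker C ?m)"
      by (subst im_arrow(4)) auto
    finally obtain r where r [simp]: "r \<in> Ar C" "Dom C r = Dom C (im C f)" "Cod C r = Ker C x"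
      "r \<cdot> ?m = im C f"
      using mono_lift[OF m, of "im C f"] by auto
    have "r \<cdot> ?k = Ide C (Dom C (im C f))"
      by (rule mono_cancel[of "im C f"]) (use r(4) in auto)
    then have "x = (r \<cdot> ?k) \<cdot> x" by simp
    also have "\<dots> = Zer C (Cod C u) (Cod C x)"
      by (subst Cmp_assoc') auto
    finally show "x = Zer C (Cod C u) (Cod C x)" .
  qed simp
  then show thesis using that u by blast
qed

text \<open>Epimorphisms are stable under pullback. The pullback of \<open>e\<close> and \<open>x\<close> is the kernel of
  \<open>p \<cdot> e - q \<cdot> x\<close> on the biproduct of their domains. That difference is itself an epimorphism, hence
  the cokernel of its kernel; this is what makes the projection \<open>w\<close> to the domain of \<open>x\<close> epi.\<close>

lemma epi_refine:
  assumes e: "is_epi C e" and x [simp]: "x \<in> Ar C" "Cod C x = Cod C e"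
  obtains w y where "is_epi C w" "w \<in> Ar C" "Cod C w = Dom C x" "y \<in> Ar C" "Dom C y = Dom C w"
    "Cod C y = Dom C e" "w \<cdot> x = y \<cdot> e"
proof -
  note e_ar [simp] = epi_arrow[OF e]
  let ?A = "Dom C e" let ?T = "Dom C x"
  have "?A \<in> Ob C" "?T \<in> Ob C" by auto
  from biproduct_exists[OF this] obtain s i j p q where
    "i \<in> Hom C ?A s \<and> j \<in> Hom C ?T s \<and> p \<in> Hom C s ?A \<and> q \<in> Hom C s ?T \<and>
        i \<cdot> p = Ide C ?A \<and> j \<cdot> q = Ide C ?T \<and> i \<cdot> q = Zer C ?A ?T \<and> j \<cdot> p = Zer C ?T ?A" by blast
  then have bp [simp]: "i \<in> Ar C" "Dom C i = ?A" "Cod C i = s" "j \<in> Ar C" "Dom C j = ?T" "Cod C j = s"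
     "p \<in> Ar C" "Dom C p = s" "Cod C p = ?A" "q \<in> Ar C" "Dom C q = s" "Cod C q = ?T"
    and eqs: "i \<cdot> p = Ide C ?A" "j \<cdot> q = Ide C ?T" "i \<cdot> q = Zer C ?A ?T"
    by (auto simp: Hom_iff)
  note eqs' = Cmp_assoc_eq[OF eqs(1)] Cmp_assoc_eq[OF eqs(2)] Cmp_assoc_eq[OF eqs(3)]
  define \<phi> where "\<phi> = p \<cdot> e \<boxminus> q \<cdot> x"
  have \<phi> [simp]: "\<phi> \<in> Ar C" "Dom C \<phi> = s" "Cod C \<phi> = Cod C e" by (auto simp: \<phi>_def)
  have i\<phi>: "i \<cdot> \<phi> = e"
    by (simp add: \<phi>_def Cmp_diff_right eqs' diff_Zer)
  then have \<phi>_epi: "is_epi C \<phi>"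
    using epi_right_factor[of i \<phi>] e by simp
  let ?k = "ker C \<phi>"
  have "?k \<cdot> \<phi> = ?k \<cdot> (p \<cdot> e) \<boxminus> ?k \<cdot> (q \<cdot> x)"
    unfolding \<phi>_def by (rule Cmp_diff_right) (auto simp: \<phi>_def[symmetric])
  then have "?k \<cdot> (p \<cdot> e) \<boxminus> ?k \<cdot> (q \<cdot> x) = Zer C (Ker C \<phi>) (Cod C e)" by simp
  then have sq: "?k \<cdot> (p \<cdot> e) = ?k \<cdot> (q \<cdot> x)"
    using diff_eq_Zer[of "?k \<cdot> (p \<cdot> e)" "?k \<cdot> (q \<cdot> x)"] by simp
  have "is_epi C (?k \<cdot> q)"
  proof (rule epi_zeroI)
    fix g assume g [simp]: "g \<in> Ar C" "Dom C g = Cod C (?k \<cdot> q)"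
      and 0: "(?k \<cdot> q) \<cdot> g = Zer C (Dom C (?k \<cdot> q)) (Cod C g)"
    \<comment> \<open>A test morphism \<open>g\<close> that kills the projection satisfies \<open>q \<cdot> g = \<phi> \<cdot> h\<close>. Restricted to the
      first summand this reads \<open>e \<cdot> h = 0\<close>, and then the second summand gives \<open>g = 0\<close>.\<close>
    obtain h where h [simp]: "h \<in> Ar C" "Dom C h = Cod C \<phi>" "Cod C h = Cod C g" and qg: "\<phi> \<cdot> h = q \<cdot> g"
      using epi_lift[OF \<phi>_epi, of "q \<cdot> g"] 0 by auto
    have "e \<cdot> h = i \<cdot> (q \<cdot> g)"
      using Cmp_assoc'[of i \<phi> h] by (simp add: i\<phi> qg)
    also have "\<dots> = Zer C ?A (Cod C g)" by (simp add: eqs')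
    finally have "h = Zer C (Cod C e) (Cod C h)"
      using epi_zero[OF e, of h] by simp
    then have "h = Zer C (Cod C e) (Cod C g)" by simp
    then have "q \<cdot> g = Zer C s (Cod C g)" using qg[symmetric] by simp
    then have "j \<cdot> (q \<cdot> g) = Zer C ?T (Cod C g)" by simp
    then show "g = Zer C (Cod C (?k \<cdot> q)) (Cod C g)" by (simp add: eqs')
  qed simp
  then show thesis using that[of "?k \<cdot> q" "?k \<cdot> p"] sq by simp
qed

text \<open>A point killed by the cokernel of \<open>f\<close> lies in the image of \<open>f\<close>, so after a refinement it has a
  preimage.\<close>

lemma coker_refine:
  assumes f [simp]: "f \<in> Ar C" and x [simp]: "x \<in> Ar C" "Cod C x = Cod C f"
    and 0: "x \<cdot> coker C f = Zer C (Dom C x) (Coker C f)"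
  obtains w y where "is_epi C w" "w \<in> Ar C" "Cod C w = Dom C x" "y \<in> Ar C" "Dom C y = Dom C w"
    "Cod C y = Dom C f" "w \<cdot> x = y \<cdot> f"
proof -
  obtain u where u: "is_epi C u" "Dom C u = Dom C f" "Cod C u = Dom C (im C f)" "u \<cdot> im C f = f"
    using image_factorization[OF f] .
  note [simp] = epi_arrow[OF u(1)] u(2,3)
  obtain v where v [simp]: "v \<in> Ar C" "Dom C v = Dom C x" "Cod C v = Dom C (im C f)" "v \<cdot> im C f = x"
    using im_lift[OF f x 0] .
  obtain w y where wy: "is_epi C w" "w \<in> Ar C" "Cod C w = Dom C v" "y \<in> Ar C" "Dom C y = Dom C w"
    "Cod C y = Dom C u" "w \<cdot> v = y \<cdot> u"
    using epi_refine[OF u(1), of v] by auto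
  note [simp] = wy(2-6)
  have "w \<cdot> x = (w \<cdot> v) \<cdot> im C f" by simp
  also have "\<dots> = y \<cdot> f" by (simp add: wy(7) u(4))
  finally show thesis using that[of w y] wy by simp
qed

section \<open>Homology of composable pairs\<close>

text \<open>Testing on all points amounts to testing on the kernel of \<open>e\<close>, of which \<open>e\<close> is the cokernel.\<close>

lemma epi_factor:
  assumes e: "is_epi C e" and s: "s \<in> Ar C" "Dom C s = Dom C e"
    and points: "\<And>x. \<lbrakk>x \<in> Ar C; Cod C x = Dom C e; x \<cdot> e = Zer C (Dom C x) (Cod C e)\<rbrakk>
      \<Longrightarrow> x \<cdot> s = Zer C (Dom C x) (Cod C s)"
  obtains u where "u \<in> Ar C" "Dom C u = Cod C e" "Cod C u = Cod C s" "e \<cdot> u = s"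
  using epi_lift[OF e s] points[of "ker C e"] epi_arrow[OF e] by auto

text \<open>The two quotients of a common object by the same kernel are isomorphic; here one of them is
  given by an epimorphism, the other as the image of an arbitrary morphism \<open>s\<close>.\<close>

lemma mono_if_same_points:
  assumes e: "is_epi C e" and s: "s \<in> Ar C" "Dom C s = Dom C e"
    and points: "\<And>x. \<lbrakk>x \<in> Ar C; Cod C x = Dom C e\<rbrakk> \<Longrightarrow>
      x \<cdot> e = Zer C (Dom C x) (Cod C e) \<longleftrightarrow> x \<cdot> s = Zer C (Dom C x) (Cod C s)"
  obtains m where "is_mono C m" "Dom C m = Cod C e" "Cod C m = Cod C s" "e \<cdot> m = s"
proof -
  note [simp] = epi_arrow[OF e] s
  obtain m where m [simp]: "m \<in> Ar C" "Dom C m = Cod C e" "Cod C m = Cod C s" and em: "e \<cdot> m = s"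
    using epi_factor[OF e s] points by metis
  have "is_mono C m"
  proof (rule mono_zeroI)
    fix x assume x [simp]: "x \<in> Ar C" "Cod C x = Dom C m" and 0: "x \<cdot> m = Zer C (Dom C x) (Cod C m)"
    obtain w y where [simp]: "is_epi C w" "w \<in> Ar C" "Cod C w = Dom C x" "y \<in> Ar C" "Dom C y = Dom C w"
      "Cod C y = Dom C e" and wx: "w \<cdot> x = y \<cdot> e"
      using epi_refine[OF e, of x] by auto
    have "y \<cdot> s = (y \<cdot> e) \<cdot> m" by (simp add: em)
    also have "\<dots> = Zer C (Dom C y) (Cod C s)" by (simp add: wx[symmetric] 0)
    finally have "w \<cdot> x = Zer C (Dom C w) (Cod C x)"
      using points[of y] by (simp add: wx)
    then show "x = Zer C (Dom C x) (Dom C m)"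
      using epi_zero[of w x] by simp
  qed simp
  then show thesis using that em by simp
qed

text \<open>The image of \<open>s\<close> is a subobject of the codomain of \<open>s\<close>. Since the kernel of \<open>s\<close> is contained in
  that of \<open>e\<close>, the epimorphism \<open>e\<close> factors through this image.\<close>

lemma subquotient_if_points:
  assumes e: "is_epi C e" and s: "s \<in> Ar C" "Dom C s = Dom C e"
    and points: "\<And>x. \<lbrakk>x \<in> Ar C; Cod C x = Dom C e; x \<cdot> s = Zer C (Dom C x) (Cod C s)\<rbrakk>
      \<Longrightarrow> x \<cdot> e = Zer C (Dom C x) (Cod C e)"
  shows "subquotient C (Cod C e) (Cod C s)"
proof -
  note [simp] = epi_arrow[OF e] s
  obtain u where u: "is_epi C u" "Dom C u = Dom C s" "Cod C u = Dom C (im C s)" "u \<cdot> im C s = s"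
    using image_factorization[OF s(1)] .
  note [simp] = epi_arrow[OF u(1)] u(2,3)
  have "x \<cdot> e = Zer C (Dom C x) (Cod C e)"
    if x: "x \<in> Ar C" "Cod C x = Dom C u" "x \<cdot> u = Zer C (Dom C x) (Cod C u)" for x
  proof (rule points)
    have "x \<cdot> s = (x \<cdot> u) \<cdot> im C s" using x(1,2) u(4) by simp
    also have "\<dots> = Zer C (Dom C x) (Cod C s)" unfolding x(3) using x(1,2) by simp
    finally show "x \<cdot> s = Zer C (Dom C x) (Cod C s)" .
  qed (use x in auto)
  then obtain e' where e': "e' \<in> Ar C" "Dom C e' = Cod C u" "Cod C e' = Cod C e" "u \<cdot> e' = e"
    using epi_factor[OF u(1), of e] by auto
  have "is_epi C e'" using epi_right_factor[of u e'] e e' by simp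
  then show ?thesis
    unfolding subquotient_def using e' by (intro exI[of _ "im C s"] exI[of _ e']) auto
qed

lemma Ker_map_arrow:
  assumes "f \<in> Ar C" "g \<in> Ar C" "u \<in> Ar C" "v \<in> Ar C" "Cod C f = Dom C v"
    "Dom C u = Dom C f" "Cod C u = Dom C g" "f \<cdot> v = u \<cdot> g"
  shows "Ker_map C f g u \<in> Ar C" "Dom C (Ker_map C f g u) = Ker C f"
    "Cod C (Ker_map C f g u) = Ker C g" "Ker_map C f g u \<cdot> ker C g = ker C f \<cdot> u"
proof -
  note [simp] = assms(1-7)
  have "(ker C f \<cdot> u) \<cdot> g = (ker C f \<cdot> f) \<cdot> v" by (simp del: ker_arrow(4) add: assms(8))
  also have "\<dots> = Zer C (Ker C f) (Cod C g)"
    using arg_cong[OF assms(8), of "Cod C"] by (subst ker_arrow(4)) simp_all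
  finally obtain r where r: "r \<in> Ar C" "Dom C r = Ker C f" "Cod C r = Ker C g" "r \<cdot> ker C g = ker C f \<cdot> u"
    using ker_lift[of g "ker C f \<cdot> u"] by auto
  then have "Ker_map C f g u = r"
    unfolding Ker_map_def by (intro factor_right_eq) auto
  with r show "Ker_map C f g u \<in> Ar C" "Dom C (Ker_map C f g u) = Ker C f"
    "Cod C (Ker_map C f g u) = Ker C g" "Ker_map C f g u \<cdot> ker C g = ker C f \<cdot> u" by simp_all
qed

lemma Coker_map_arrow:
  assumes "f \<in> Ar C" "g \<in> Ar C" "u \<in> Ar C" "v \<in> Ar C" "Cod C u = Dom C g"
    "Dom C v = Cod C f" "Cod C v = Cod C g" "f \<cdot> v = u \<cdot> g"
  shows "Coker_map C f g v \<in> Ar C" "Dom C (Coker_map C f g v) = Coker C f"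
    "Cod C (Coker_map C f g v) = Coker C g" "coker C f \<cdot> Coker_map C f g v = v \<cdot> coker C g"
proof -
  note [simp] = assms(1-7)
  have "f \<cdot> (v \<cdot> coker C g) = u \<cdot> (g \<cdot> coker C g)"
    by (simp del: coker_arrow(4) add: Cmp_assoc_eq[OF assms(8)])
  also have "\<dots> = Zer C (Dom C f) (Coker C g)"
    using arg_cong[OF assms(8), of "Dom C"] by (subst coker_arrow(4)) simp_all
  finally obtain r where r: "r \<in> Ar C" "Dom C r = Coker C f" "Cod C r = Coker C g" "coker C f \<cdot> r = v \<cdot> coker C g"
    using coker_lift[of f "v \<cdot> coker C g"] by auto
  then have "Coker_map C f g v = r"
    unfolding Coker_map_def by (intro factor_left_eq) auto
  with r show "Coker_map C f g v \<in> Ar C" "Dom C (Coker_map C f g v) = Coker C f"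
    "Cod C (Coker_map C f g v) = Coker C g" "coker C f \<cdot> Coker_map C f g v = v \<cdot> coker C g" by simp_all
qed

lemma H_mono_arrow [simp]:
  assumes "f \<in> Ar C" "g \<in> Ar C" "Cod C f = Dom C g"
  shows "H_mono C f g \<in> Ar C" "Dom C (H_mono C f g) = H C f g" "Cod C (H_mono C f g) = Coker C f"
    "is_mono C (H_mono C f g)" "H C f g \<in> Ob C"
  using assms by (auto simp: H_def H_mono_def)

lemma H_epi_arrow [simp]:
  assumes "f \<in> Ar C" "g \<in> Ar C" "Cod C f = Dom C g"
  shows "H_epi C f g \<in> Ar C" "Dom C (H_epi C f g) = Ker C g" "Cod C (H_epi C f g) = H C f g"
    "is_epi C (H_epi C f g)" "H_epi C f g \<cdot> H_mono C f g = ker C g \<cdot> coker C f"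
proof -
  note [simp] = assms
  obtain u where u: "is_epi C u" "Dom C u = Ker C g" "Cod C u = H C f g"
    "u \<cdot> H_mono C f g = ker C g \<cdot> coker C f"
    using image_factorization[of "ker C g \<cdot> coker C f"] by (auto simp: H_def H_mono_def)
  then have "H_epi C f g = u"
    unfolding H_epi_def by (intro factor_right_eq) (auto simp: epi_arrow)
  with u show "H_epi C f g \<in> Ar C" "Dom C (H_epi C f g) = Ker C g" "Cod C (H_epi C f g) = H C f g"
    "is_epi C (H_epi C f g)" "H_epi C f g \<cdot> H_mono C f g = ker C g \<cdot> coker C f"
    by (simp_all add: epi_arrow)
qed

text \<open>The homology is never accessed through its construction as an image: a cycle represents zero
  exactly if it vanishes in the cokernel of \<open>f\<close>.\<close>

lemma H_epi_zero_iff: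
  assumes "f \<in> Ar C" "g \<in> Ar C" "Cod C f = Dom C g" "x \<in> Ar C" "Cod C x = Ker C g"
  shows "x \<cdot> H_epi C f g = Zer C (Dom C x) (H C f g) \<longleftrightarrow>
    x \<cdot> (ker C g \<cdot> coker C f) = Zer C (Dom C x) (Coker C f)"
proof
  note [simp] = assms
  have eq: "x \<cdot> (ker C g \<cdot> coker C f) = (x \<cdot> H_epi C f g) \<cdot> H_mono C f g" by simp
  show "x \<cdot> (ker C g \<cdot> coker C f) = Zer C (Dom C x) (Coker C f)"
    if "x \<cdot> H_epi C f g = Zer C (Dom C x) (H C f g)"
    unfolding eq that by simp
  show "x \<cdot> H_epi C f g = Zer C (Dom C x) (H C f g)"
    if "x \<cdot> (ker C g \<cdot> coker C f) = Zer C (Dom C x) (Coker C f)"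
    using mono_zero[of "H_mono C f g" "x \<cdot> H_epi C f g"] that eq by simp
qed

text \<open>The description \<open>H_map\<close> of the induced morphism determines it because \<open>H_epi\<close> is an
  epimorphism. It exists because the morphism induced on kernels sends cycles representing zero to
  cycles representing zero, which is where the square of \<open>f\<close> and \<open>f'\<close> enters.\<close>

lemma H_map_arrow:
  assumes f: "f \<in> Ar C" "g \<in> Ar C" "Cod C f = Dom C g"
    and f': "f' \<in> Ar C" "g' \<in> Ar C" "Cod C f' = Dom C g'"
    and uvw: "u \<in> Ar C" "v \<in> Ar C" "w \<in> Ar C"
    and ends: "Cod C u = Dom C f'" "Dom C v = Cod C f" "Cod C v = Cod C f'" "Dom C w = Cod C g"
    and sq: "f \<cdot> v = u \<cdot> f'" "g \<cdot> w = v \<cdot> g'"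
  shows "H_map C f g f' g' v \<in> Ar C" "Dom C (H_map C f g f' g' v) = H C f g"
    "Cod C (H_map C f g f' g' v) = H C f' g'"
    "H_epi C f g \<cdot> H_map C f g f' g' v = Ker_map C g g' v \<cdot> H_epi C f' g'"
proof -
  note [simp] = f f' uvw ends
  have gv: "Dom C v = Dom C g" "Cod C v = Dom C g'" using ends f f' by auto
  note K [simp] = Ker_map_arrow[OF f(2) f'(2) uvw(2,3) ends(4)[symmetric] gv sq(2)]
  note Q [simp] = Coker_map_arrow[OF f(1) f'(1) uvw(1,2) ends(1-3) sq(1)]
  let ?s = "Ker_map C g g' v \<cdot> H_epi C f' g'"
  have s_mono: "?s \<cdot> H_mono C f' g' = (ker C g \<cdot> coker C f) \<cdot> Coker_map C f f' v"
    by (simp add: Cmp_assoc_eq[OF K(4)])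
  have "x \<cdot> ?s = Zer C (Dom C x) (Cod C ?s)"
    if x: "x \<in> Ar C" "Cod C x = Ker C g" "x \<cdot> H_epi C f g = Zer C (Dom C x) (H C f g)" for x
  proof -
    have "(x \<cdot> ?s) \<cdot> H_mono C f' g' = x \<cdot> (?s \<cdot> H_mono C f' g')"
      using x(1,2) by (intro Cmp_assoc') auto
    also have "\<dots> = (x \<cdot> (ker C g \<cdot> coker C f)) \<cdot> Coker_map C f f' v"
      using x(1,2) unfolding s_mono by simp
    also have "x \<cdot> (ker C g \<cdot> coker C f) = Zer C (Dom C x) (Coker C f)"
      using x H_epi_zero_iff[OF f x(1,2)] by simp
    finally show ?thesis
      using mono_zero[of "H_mono C f' g'" "x \<cdot> ?s"] x(1,2) by simp
  qed
  then obtain t where t [simp]: "t \<in> Ar C" "Dom C t = H C f g" "Cod C t = H C f' g'"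
    and et: "H_epi C f g \<cdot> t = ?s"
    using epi_factor[of "H_epi C f g" ?s] by auto
  have "t \<cdot> H_mono C f' g' = H_mono C f g \<cdot> Coker_map C f f' v"
  proof (rule epi_cancel)
    show "H_epi C f g \<cdot> (t \<cdot> H_mono C f' g') = H_epi C f g \<cdot> (H_mono C f g \<cdot> Coker_map C f f' v)"
      using s_mono
      by (simp add: Cmp_assoc_eq[OF et] Cmp_assoc_eq[OF H_epi_arrow(5)[OF f]] del: Q(4) K(4))
  qed auto
  then have "H_map C f g f' g' v = t"
    unfolding H_map_def
    using et by (intro the_equality)
      (auto simp: Hom_iff intro: epi_cancel[of "H_epi C f g"])
  then show "H_map C f g f' g' v \<in> Ar C" "Dom C (H_map C f g f' g' v) = H C f g"
    "Cod C (H_map C f g f' g' v) = H C f' g'" "H_epi C f g \<cdot> H_map C f g f' g' v = ?s"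
    using et by simp_all
qed

lemma zero_Ker_iff_mono:
  assumes [simp]: "f \<in> Ar C"
  shows "zero_object C (Ker C f) \<longleftrightarrow> is_mono C f"
proof
  assume z: "zero_object C (Ker C f)"
  show "is_mono C f"
  proof (rule mono_zeroI)
    fix x assume [simp]: "x \<in> Ar C" "Cod C x = Dom C f" and "x \<cdot> f = Zer C (Dom C x) (Cod C f)"
    then obtain u where u: "u \<in> Ar C" "Dom C u = Dom C x" "Cod C u = Ker C f" "u \<cdot> ker C f = x"
      using ker_lift[of f x] by auto
    have "u = Zer C (Dom C x) (Ker C f)" using zero_object_Cod[OF z u(1,3)] u(2) by simp
    then show "x = Zer C (Dom C x) (Dom C f)" using u(4) by simp
  qed simp
next
  assume "is_mono C f"
  then have 0: "ker C f = Zer C (Ker C f) (Dom C f)"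
    using mono_zero[of f "ker C f"] by simp
  have "Ide C (Ker C f) = Zer C (Ker C f) (Ker C f)"
    by (rule mono_cancel[of "ker C f"]) (simp_all, simp add: 0)
  then show "zero_object C (Ker C f)" by (simp add: zero_object_iff)
qed

text \<open>The composite \<open>ker C g \<cdot> coker C f\<close> factors as an epimorphism onto the homology followed by a
  monomorphism.\<close>

lemma zero_H_iff:
  assumes fg [simp]: "f \<in> Ar C" "g \<in> Ar C" "Cod C f = Dom C g"
  shows "zero_object C (H C f g) \<longleftrightarrow> ker C g \<cdot> coker C f = Zer C (Ker C g) (Coker C f)"
proof
  assume "zero_object C (H C f g)"
  then have "H_epi C f g = Zer C (Ker C g) (H C f g)"
    using zero_object_Cod[of "H C f g" "H_epi C f g"] by simp
  then show "ker C g \<cdot> coker C f = Zer C (Ker C g) (Coker C f)"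
    using H_epi_arrow(5)[OF fg] by simp
next
  assume 0: "ker C g \<cdot> coker C f = Zer C (Ker C g) (Coker C f)"
  have e0: "H_epi C f g = Zer C (Ker C g) (H C f g)"
    using H_epi_zero_iff[OF fg, of "Ide C (Ker C g)"] 0 by simp
  have "Ide C (H C f g) = Zer C (H C f g) (H C f g)"
    by (rule epi_cancel[of "H_epi C f g"]) (simp_all, simp add: e0)
  then show "zero_object C (H C f g)" by (simp add: zero_object_iff)
qed

text \<open>For a complex, the image of \<open>f\<close> is contained in the kernel of \<open>g\<close>; vanishing homology is the
  reverse inclusion.\<close>

lemma exact_iff_zero_H:
  assumes fg [simp]: "f \<in> Ar C" "g \<in> Ar C" "Cod C f = Dom C g"
    and 0: "f \<cdot> g = Zer C (Dom C f) (Cod C g)"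
  shows "exact C f g \<longleftrightarrow> zero_object C (H C f g)"
proof
  assume "exact C f g"
  then have "is_kernel C (im C f) g" by (simp add: exact_def)
  from kernel_lift[OF this, of "ker C g"]
  obtain u where [simp]: "u \<in> Ar C" "Dom C u = Ker C g" "Cod C u = Dom C (im C f)" 
    and u: "u \<cdot> im C f = ker C g" by auto
  have "ker C g \<cdot> coker C f = Zer C (Ker C g) (Coker C f)"
    unfolding u[symmetric] by simp
  then show "zero_object C (H C f g)" by (simp add: zero_H_iff)
next
  assume "zero_object C (H C f g)"
  then have z: "ker C g \<cdot> coker C f = Zer C (Ker C g) (Coker C f)" by (simp add: zero_H_iff)
  obtain u where u: "is_epi C u" "Dom C u = Dom C f" "Cod C u = Dom C (im C f)" "u \<cdot> im C f = f"
    using image_factorization[OF fg(1)] .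
  have "u \<cdot> (im C f \<cdot> g) = Zer C (Dom C f) (Cod C g)"
    using u 0 by (simp add: Cmp_assoc_eq[OF u(4)] epi_arrow)
  then have img: "im C f \<cdot> g = Zer C (Dom C (im C f)) (Cod C g)"
    using epi_zero[OF u(1), of "im C f \<cdot> g"] u by simp
  have "\<exists>!v. v \<in> Hom C t (Dom C (im C f)) \<and> v \<cdot> im C f = x"
    if x: "x \<in> Hom C t (Dom C g)" "x \<cdot> g = Zer C t (Cod C g)" for t x
  proof -
    obtain y where y: "y \<in> Ar C" "Dom C y = t" "Cod C y = Ker C g" "y \<cdot> ker C g = x"
      using ker_lift[of g x] x by (auto simp: Hom_iff)
    then have "x \<cdot> coker C f = y \<cdot> (ker C g \<cdot> coker C f)" by (simp add: Cmp_assoc_eq[OF y(4)])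
    also have "\<dots> = Zer C t (Coker C f)" using y by (simp add: z)
    finally obtain v where v: "v \<in> Ar C" "Dom C v = t" "Cod C v = Dom C (im C f)" "v \<cdot> im C f = x"
      using im_lift[OF fg(1), of x] x by (auto simp: Hom_iff)
    then show ?thesis
      by (intro ex1I[of _ v]) (auto simp: Hom_iff intro: mono_cancel[OF im_arrow(3)[OF fg(1)]])
  qed
  then show "exact C f g"
    unfolding exact_def is_kernel_def using img by simp
qed

end

section \<open>The ladder\<close>

locale ladder = abelian_category C
  for C :: "('o, 'm, 'r) preadditive_data_scheme" (structure) +
  fixes a b c d e f g h :: 'o
    and \<alpha> \<beta> \<gamma> \<theta> \<iota> \<kappa> \<delta> \<epsilon> \<zeta> \<eta> :: 'm
  assumes rows: "\<alpha> \<in> Hom C a b" "\<beta> \<in> Hom C b c" "\<gamma> \<in> Hom C c d"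
      "\<theta> \<in> Hom C e f" "\<iota> \<in> Hom C f g" "\<kappa> \<in> Hom C g h"
    and columns: "\<delta> \<in> Hom C a e" "\<epsilon> \<in> Hom C b f" "\<zeta> \<in> Hom C c g" "\<eta> \<in> Hom C d h"
    and squares: "\<alpha> \<cdot> \<epsilon> = \<delta> \<cdot> \<theta>" "\<beta> \<cdot> \<zeta> = \<epsilon> \<cdot> \<iota>" "\<gamma> \<cdot> \<eta> = \<zeta> \<cdot> \<kappa>"
    and complexes: "\<alpha> \<cdot> \<beta> = Zer C a c" "\<beta> \<cdot> \<gamma> = Zer C b d"
      "\<theta> \<cdot> \<iota> = Zer C e g" "\<iota> \<cdot> \<kappa> = Zer C f h"
    and \<delta>_epi: "is_epi C \<delta>" and \<eta>_mono: "is_mono C \<eta>"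
begin

lemma ladder_arrow [simp]:
  "\<alpha> \<in> Ar C" "Dom C \<alpha> = a" "Cod C \<alpha> = b" "\<beta> \<in> Ar C" "Dom C \<beta> = b" "Cod C \<beta> = c"
  "\<gamma> \<in> Ar C" "Dom C \<gamma> = c" "Cod C \<gamma> = d" "\<theta> \<in> Ar C" "Dom C \<theta> = e" "Cod C \<theta> = f"
  "\<iota> \<in> Ar C" "Dom C \<iota> = f" "Cod C \<iota> = g" "\<kappa> \<in> Ar C" "Dom C \<kappa> = g" "Cod C \<kappa> = h"
  "\<delta> \<in> Ar C" "Dom C \<delta> = a" "Cod C \<delta> = e" "\<epsilon> \<in> Ar C" "Dom C \<epsilon> = b" "Cod C \<epsilon> = f"
  "\<zeta> \<in> Ar C" "Dom C \<zeta> = c" "Cod C \<zeta> = g" "\<eta> \<in> Ar C" "Dom C \<eta> = d" "Cod C \<eta> = h"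
  using rows columns by (auto simp: Hom_iff)

lemma ladder_Ob [simp]: "a \<in> Ob C" "b \<in> Ob C" "c \<in> Ob C" "d \<in> Ob C"
  "e \<in> Ob C" "f \<in> Ob C" "g \<in> Ob C" "h \<in> Ob C"
  using Dom_closed Cod_closed ladder_arrow by metis+

definition kmap where "kmap = Ker_map C \<epsilon> \<zeta> \<beta>"

lemma kmap_arrow [simp]: "kmap \<in> Ar C" "Dom C kmap = Ker C \<epsilon>" "Cod C kmap = Ker C \<zeta>"
    "kmap \<cdot> ker C \<zeta> = ker C \<epsilon> \<cdot> \<beta>"
  using Ker_map_arrow[of \<epsilon> \<zeta> \<beta> \<iota>] squares by (auto simp: kmap_def)

definition kclass where "kclass = factor_right C (ker C \<gamma>) (ker C \<zeta>) \<cdot> H_epi C \<beta> \<gamma>"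

text \<open>Because \<open>\<eta>\<close> is a monomorphism, \<open>Ker \<zeta>\<close> is contained in \<open>Ker \<gamma>\<close>, so that its elements have
  classes in \<open>H(\<beta>, \<gamma>)\<close>.\<close>

lemma kclass_arrow [simp]: "kclass \<in> Ar C" "Dom C kclass = Ker C \<zeta>" "Cod C kclass = H C \<beta> \<gamma>"
  and kclass_zero_iff: "\<And>x. \<lbrakk>x \<in> Ar C; Cod C x = Ker C \<zeta>\<rbrakk> \<Longrightarrow>
    x \<cdot> kclass = Zer C (Dom C x) (H C \<beta> \<gamma>) \<longleftrightarrow> x \<cdot> (ker C \<zeta> \<cdot> coker C \<beta>) = Zer C (Dom C x) (Coker C \<beta>)"
proof -
  have "(ker C \<zeta> \<cdot> \<gamma>) \<cdot> \<eta> = (ker C \<zeta> \<cdot> \<zeta>) \<cdot> \<kappa>"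
    by (simp add: squares(3) del: ker_arrow(4))
  also have "\<dots> = Zer C (Ker C \<zeta>) h" by (subst ker_arrow(4)) auto
  finally have "ker C \<zeta> \<cdot> \<gamma> = Zer C (Ker C \<zeta>) d"
    using mono_zero[OF \<eta>_mono, of "ker C \<zeta> \<cdot> \<gamma>"] by simp
  then obtain j where j [simp]: "j \<in> Ar C" "Dom C j = Ker C \<zeta>" "Cod C j = Ker C \<gamma>"
    and jk: "j \<cdot> ker C \<gamma> = ker C \<zeta>"
    using ker_lift[of \<gamma> "ker C \<zeta>"] by auto
  have kclass: "kclass = j \<cdot> H_epi C \<beta> \<gamma>"
    using jk unfolding kclass_def by (subst factor_right_eq[of "ker C \<gamma>" j]) auto
  then show "kclass \<in> Ar C" "Dom C kclass = Ker C \<zeta>" "Cod C kclass = H C \<beta> \<gamma>" by auto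
  fix x assume x: "x \<in> Ar C" "Cod C x = Ker C \<zeta>"
  show "x \<cdot> kclass = Zer C (Dom C x) (H C \<beta> \<gamma>) \<longleftrightarrow>
    x \<cdot> (ker C \<zeta> \<cdot> coker C \<beta>) = Zer C (Dom C x) (Coker C \<beta>)"
    using H_epi_zero_iff[of \<beta> \<gamma> "x \<cdot> j"] x by (simp add: kclass Cmp_assoc_eq[OF jk])
qed

text \<open>The object \<open>K\<close> parametrises the \<open>y\<close> in \<open>b\<close> with \<open>\<zeta>(\<beta>(y)) = 0\<close>, on which the diagram chase
  runs. From it, \<open>left\<close> sends \<open>y\<close> to \<open>\<beta>(y)\<close> in the kernel of \<open>kclass\<close>, and \<open>right\<close> sends \<open>y\<close> to
  the class of \<open>\<epsilon>(y)\<close> in \<open>H(\<theta>, \<iota>)\<close>.\<close>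

definition incl where "incl = ker C (\<beta> \<cdot> \<zeta>)"

abbreviation K where "K \<equiv> Ker C (\<beta> \<cdot> \<zeta>)"

lemma incl_arrow [simp]: "incl \<in> Ar C" "Dom C incl = K" "Cod C incl = b" "is_mono C incl"
    "incl \<cdot> (\<beta> \<cdot> \<zeta>) = Zer C K g"
  using ker_arrow[of "\<beta> \<cdot> \<zeta>"] unfolding incl_def by simp_all

definition left where "left = factor_right C (ker C kclass) (Ker_map C (\<beta> \<cdot> \<zeta>) \<zeta> \<beta>)"

text \<open>That \<open>left\<close> is an epimorphism means: an element of \<open>Ker \<zeta>\<close> with trivial class in \<open>H(\<beta>, \<gamma>)\<close>
  comes from \<open>b\<close>, and any preimage lies in \<open>K\<close>. This is tested on the universal such element,
  the identity of \<open>Ker kclass\<close>.\<close>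

lemma left_arrow [simp]: "left \<in> Ar C" "Dom C left = K" "Cod C left = Ker C kclass"
  and left_ker: "left \<cdot> (ker C kclass \<cdot> ker C \<zeta>) = incl \<cdot> \<beta>"
  and left_epi: "is_epi C left"
proof -
  let ?q = "Ker_map C (\<beta> \<cdot> \<zeta>) \<zeta> \<beta>"
  have q [simp]: "?q \<in> Ar C" "Dom C ?q = K" "Cod C ?q = Ker C \<zeta>" 
    and qk: "?q \<cdot> ker C \<zeta> = incl \<cdot> \<beta>"
    using Ker_map_arrow[of "\<beta> \<cdot> \<zeta>" \<zeta> \<beta> "Ide C g"] by (auto simp: incl_def)
  have "?q \<cdot> (ker C \<zeta> \<cdot> coker C \<beta>) = Zer C K (Coker C \<beta>)"
    by (simp add: Cmp_assoc_eq[OF qk])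
  then have "?q \<cdot> kclass = Zer C K (H C \<beta> \<gamma>)"
    using kclass_zero_iff[of ?q] by simp
  then obtain r where r [simp]: "r \<in> Ar C" "Dom C r = K" "Cod C r = Ker C kclass" and rk: "r \<cdot> ker C kclass = ?q"
    using ker_lift[of kclass ?q] by auto
  have pr: "left = r"
    unfolding left_def using rk by (intro factor_right_eq) auto
  then show pA [simp]: "left \<in> Ar C" "Dom C left = K" "Cod C left = Ker C kclass" by auto
  show pk: "left \<cdot> (ker C kclass \<cdot> ker C \<zeta>) = incl \<cdot> \<beta>"
    unfolding pr using qk by (simp add: Cmp_assoc_eq[OF rk])
  let ?x = "ker C kclass \<cdot> ker C \<zeta>"
  have "ker C kclass \<cdot> (ker C \<zeta> \<cdot> coker C \<beta>) = Zer C (Ker C kclass) (Coker C \<beta>)"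
    using kclass_zero_iff[of "ker C kclass"] by simp
  then obtain w y where w [simp]: "is_epi C w" "w \<in> Ar C" "Cod C w = Ker C kclass"
      "y \<in> Ar C" "Dom C y = Dom C w" "Cod C y = b"
    and wy: "w \<cdot> ?x = y \<cdot> \<beta>"
    using coker_refine[of \<beta> ?x] by auto
  have "y \<cdot> (\<beta> \<cdot> \<zeta>) = w \<cdot> (ker C kclass \<cdot> (ker C \<zeta> \<cdot> \<zeta>))"
    by (simp add: Cmp_assoc_eq[OF wy[symmetric]] del: ker_arrow(4))
  also have "\<dots> = Zer C (Dom C y) g" by simp
  finally obtain y' where y' [simp]: "y' \<in> Ar C" "Dom C y' = Dom C w" "Cod C y' = K" and yk: "y' \<cdot> incl = y"
    using ker_lift[of "\<beta> \<cdot> \<zeta>" y] by (auto simp: incl_def)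
  have "is_mono C ?x" by (intro mono_Cmp) auto
  then have "y' \<cdot> left = w"
    by (rule mono_cancel) (simp_all add: pk wy Cmp_assoc_eq[OF yk])
  then show "is_epi C left"
    using epi_right_factor[of y' left] w by simp
qed

definition right where "right = Ker_map C (\<beta> \<cdot> \<zeta>) \<iota> \<epsilon> \<cdot> H_epi C \<theta> \<iota>"

lemma lift_\<epsilon> [simp]: "Ker_map C (\<beta> \<cdot> \<zeta>) \<iota> \<epsilon> \<in> Ar C" "Dom C (Ker_map C (\<beta> \<cdot> \<zeta>) \<iota> \<epsilon>) = K"
    "Cod C (Ker_map C (\<beta> \<cdot> \<zeta>) \<iota> \<epsilon>) = Ker C \<iota>"
  and lift_\<epsilon>_ker: "Ker_map C (\<beta> \<cdot> \<zeta>) \<iota> \<epsilon> \<cdot> ker C \<iota> = incl \<cdot> \<epsilon>"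
  using Ker_map_arrow[of "\<beta> \<cdot> \<zeta>" \<iota> \<epsilon> "Ide C g"] squares(2) by (auto simp: incl_def)

lemma right_arrow [simp]: "right \<in> Ar C" "Dom C right = K" "Cod C right = H C \<theta> \<iota>"
  by (simp_all add: right_def)

abbreviation H\<epsilon> where "H\<epsilon> \<equiv> H_map C \<alpha> \<beta> \<theta> \<iota> \<epsilon>"

lemma H\<epsilon>_arrow [simp]: "H\<epsilon> \<in> Ar C" "Dom C H\<epsilon> = H C \<alpha> \<beta>" "Cod C H\<epsilon> = H C \<theta> \<iota>"
  and H\<epsilon>_epi: "H_epi C \<alpha> \<beta> \<cdot> H\<epsilon> = Ker_map C \<beta> \<iota> \<epsilon> \<cdot> H_epi C \<theta> \<iota>"
  using H_map_arrow[of \<alpha> \<beta> \<theta> \<iota> \<delta> \<epsilon> \<zeta>] squares by auto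

lemma ker\<beta>_arrow [simp]: "Ker_map C \<beta> \<iota> \<epsilon> \<in> Ar C" "Dom C (Ker_map C \<beta> \<iota> \<epsilon>) = Ker C \<beta>"
    "Cod C (Ker_map C \<beta> \<iota> \<epsilon>) = Ker C \<iota>"
  and ker\<beta>_ker: "Ker_map C \<beta> \<iota> \<epsilon> \<cdot> ker C \<iota> = ker C \<beta> \<cdot> \<epsilon>"
  using Ker_map_arrow[of \<beta> \<iota> \<epsilon> \<zeta>] squares by auto

text \<open>The common description, in terms of refined points, of the kernels of the two morphisms from
  \<open>K\<close> that are to be compared.\<close>

definition image_from_ker where
  "image_from_ker t \<longleftrightarrow> (\<exists>w n. is_epi C w \<and> Cod C w = Dom C t \<and> n \<in> Hom C (Dom C w) b \<and>
    n \<cdot> \<epsilon> = Zer C (Dom C w) f \<and> w \<cdot> (t \<cdot> (incl \<cdot> \<beta>)) = n \<cdot> \<beta>)"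

text \<open>The homology at \<open>Ker \<zeta>\<close> divides by the image of \<open>Ker \<epsilon>\<close>, so a point of \<open>K\<close> dies there exactly
  if its image under \<open>\<beta>\<close> comes from \<open>Ker \<epsilon>\<close>.\<close>

lemma image_from_ker_iff_left:
  assumes t [simp]: "t \<in> Ar C" "Cod C t = K"
  shows "t \<cdot> (left \<cdot> (ker C kclass \<cdot> coker C kmap)) = Zer C (Dom C t) (Coker C kmap) \<longleftrightarrow> image_from_ker t"
proof
  assume 0: "t \<cdot> (left \<cdot> (ker C kclass \<cdot> coker C kmap)) = Zer C (Dom C t) (Coker C kmap)"
  obtain w n where w [simp]: "is_epi C w" "w \<in> Ar C" "Cod C w = Dom C t"
      "n \<in> Ar C" "Dom C n = Dom C w" "Cod C n = Ker C \<epsilon>"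
    and wn: "w \<cdot> (t \<cdot> (left \<cdot> ker C kclass)) = n \<cdot> kmap"
    using coker_refine[of kmap "t \<cdot> (left \<cdot> ker C kclass)"] 0 by auto
  have "w \<cdot> (t \<cdot> (incl \<cdot> \<beta>)) = (w \<cdot> (t \<cdot> (left \<cdot> ker C kclass))) \<cdot> ker C \<zeta>"
    by (simp add: left_ker)
  also have "\<dots> = (n \<cdot> ker C \<epsilon>) \<cdot> \<beta>" by (simp add: wn)
  finally show "image_from_ker t"
    unfolding image_from_ker_def using w
    by (intro exI[of _ w] exI[of _ "n \<cdot> ker C \<epsilon>"]) (simp add: Hom_iff)
next
  assume "image_from_ker t"
  then obtain w n where w: "is_epi C w" and [simp]: "Cod C w = Dom C t" "n \<in> Ar C" "Dom C n = Dom C w" "Cod C n = b"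
    and n: "n \<cdot> \<epsilon> = Zer C (Dom C w) f" "w \<cdot> (t \<cdot> (incl \<cdot> \<beta>)) = n \<cdot> \<beta>"
    by (auto simp: image_from_ker_def Hom_iff)
  note [simp] = epi_arrow[OF w]
  obtain n' where [simp]: "n' \<in> Ar C" "Dom C n' = Dom C w" "Cod C n' = Ker C \<epsilon>" and n': "n' \<cdot> ker C \<epsilon> = n"
    using ker_lift[of \<epsilon> n] n by auto
  have "w \<cdot> (t \<cdot> (left \<cdot> ker C kclass)) = n' \<cdot> kmap"
    by (rule mono_cancel[of "ker C \<zeta>"]) (simp_all add: left_ker n Cmp_assoc_eq[OF n'])
  then have "w \<cdot> (t \<cdot> (left \<cdot> (ker C kclass \<cdot> coker C kmap))) = Zer C (Dom C w) (Coker C kmap)"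
    using Cmp_assoc_eq[of w "t \<cdot> (left \<cdot> ker C kclass)" "n' \<cdot> kmap" "coker C kmap"] by simp
  then show "t \<cdot> (left \<cdot> (ker C kclass \<cdot> coker C kmap)) = Zer C (Dom C t) (Coker C kmap)"
    using epi_zero[OF w, of "t \<cdot> (left \<cdot> (ker C kclass \<cdot> coker C kmap))"] by simp
qed

text \<open>The core of the chase. If \<open>\<epsilon>(t)\<close> dies in the cokernel, it is the sum of an element of the image
  of \<open>\<theta>\<close>, which the epimorphism \<open>\<delta>\<close> moves to the image of \<open>\<alpha>\<close>, and of the image under \<open>\<epsilon>\<close> of a
  cycle of \<open>\<beta>\<close>. Subtracting both corrections from \<open>t\<close> does not change \<open>\<beta>(t)\<close>
  and leaves an element of \<open>Ker \<epsilon>\<close>. Conversely, \<open>t\<close> then differs from an element of \<open>Ker \<epsilon>\<close>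
  by a cycle of \<open>\<beta>\<close>, so \<open>\<epsilon>(t)\<close> represents a class in the image of \<open>H(\<alpha>, \<beta>)\<close>.\<close>

lemma image_from_ker_iff_right:
  assumes t [simp]: "t \<in> Ar C" "Cod C t = K"
  shows "t \<cdot> (right \<cdot> coker C H\<epsilon>) = Zer C (Dom C t) (Coker C H\<epsilon>) \<longleftrightarrow> image_from_ker t"
proof
  let ?l = "Ker_map C (\<beta> \<cdot> \<zeta>) \<iota> \<epsilon>" let ?m = "Ker_map C \<beta> \<iota> \<epsilon>"
  assume 0: "t \<cdot> (right \<cdot> coker C H\<epsilon>) = Zer C (Dom C t) (Coker C H\<epsilon>)"
  \<comment> \<open>the class of \<open>\<epsilon>(t)\<close> comes from a class in \<open>H(\<alpha>, \<beta>)\<close>, represented by the cycle \<open>z2\<close>\<close>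
  obtain w1 z1 where w1 [simp]: "is_epi C w1" "w1 \<in> Ar C" "Cod C w1 = Dom C t"
      "z1 \<in> Ar C" "Dom C z1 = Dom C w1" "Cod C z1 = H C \<alpha> \<beta>"
    and e1: "w1 \<cdot> (t \<cdot> right) = z1 \<cdot> H\<epsilon>"
    using coker_refine[of H\<epsilon> "t \<cdot> right"] 0 by auto
  obtain w2 z2 where w2 [simp]: "is_epi C w2" "w2 \<in> Ar C" "Cod C w2 = Dom C w1"
      "z2 \<in> Ar C" "Dom C z2 = Dom C w2" "Cod C z2 = Ker C \<beta>"
    and e2: "w2 \<cdot> z1 = z2 \<cdot> H_epi C \<alpha> \<beta>"
    using epi_refine[of "H_epi C \<alpha> \<beta>" z1] by auto
  define x where "x = w2 \<cdot> (w1 \<cdot> t)"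
  have x [simp]: "x \<in> Ar C" "Dom C x = Dom C w2" "Cod C x = K" by (simp_all add: x_def)
  have "(x \<cdot> ?l) \<cdot> H_epi C \<theta> \<iota> = (z2 \<cdot> ?m) \<cdot> H_epi C \<theta> \<iota>"
  proof -
    have "(x \<cdot> ?l) \<cdot> H_epi C \<theta> \<iota> = w2 \<cdot> (w1 \<cdot> (t \<cdot> right))" by (simp add: x_def right_def)
    also have "\<dots> = (w2 \<cdot> z1) \<cdot> H\<epsilon>" by (simp add: e1)
    also have "\<dots> = z2 \<cdot> (H_epi C \<alpha> \<beta> \<cdot> H\<epsilon>)" by (simp add: e2)
    finally show ?thesis by (simp add: H\<epsilon>_epi)
  qed
  then have "(x \<cdot> ?l \<boxminus> z2 \<cdot> ?m) \<cdot> H_epi C \<theta> \<iota> = Zer C (Dom C w2) (H C \<theta> \<iota>)"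
    using diff_eq_Zer[of "(x \<cdot> ?l) \<cdot> H_epi C \<theta> \<iota>" "(z2 \<cdot> ?m) \<cdot> H_epi C \<theta> \<iota>"]
    by (simp add: Cmp_diff_left)
  then have "(x \<cdot> ?l \<boxminus> z2 \<cdot> ?m) \<cdot> (ker C \<iota> \<cdot> coker C \<theta>) = Zer C (Dom C w2) (Coker C \<theta>)"
    using H_epi_zero_iff[of \<theta> \<iota> "x \<cdot> ?l \<boxminus> z2 \<cdot> ?m"] by simp
  moreover define y where "y = x \<cdot> incl \<boxminus> z2 \<cdot> ker C \<beta>"
  have y [simp]: "y \<in> Ar C" "Dom C y = Dom C w2" "Cod C y = b" by (simp_all add: y_def)
  have "(x \<cdot> ?l \<boxminus> z2 \<cdot> ?m) \<cdot> ker C \<iota> = y \<cdot> \<epsilon>"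
    by (simp add: y_def Cmp_diff_left lift_\<epsilon>_ker ker\<beta>_ker)
  note Cmp_assoc_eq[OF this, of "coker C \<theta>"]
  ultimately have y\<epsilon>: "y \<cdot> (\<epsilon> \<cdot> coker C \<theta>) = Zer C (Dom C w2) (Coker C \<theta>)" by simp
  have y\<beta>: "y \<cdot> \<beta> = x \<cdot> (incl \<cdot> \<beta>)"
    by (simp add: y_def Cmp_diff_left diff_Zer)
  \<comment> \<open>\<open>y\<close> is \<open>t\<close> minus that cycle; \<open>\<epsilon>(y)\<close> is a boundary \<open>\<theta>(u)\<close>, and \<open>u\<close> lifts along \<open>\<delta>\<close>\<close>
  obtain w3 u where w3 [simp]: "is_epi C w3" "w3 \<in> Ar C" "Cod C w3 = Dom C w2"
      "u \<in> Ar C" "Dom C u = Dom C w3" "Cod C u = e"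
    and e3: "w3 \<cdot> (y \<cdot> \<epsilon>) = u \<cdot> \<theta>"
    using coker_refine[of \<theta> "y \<cdot> \<epsilon>"] y\<epsilon> by auto
  obtain w4 u' where w4 [simp]: "is_epi C w4" "w4 \<in> Ar C" "Cod C w4 = Dom C w3"
      "u' \<in> Ar C" "Dom C u' = Dom C w4" "Cod C u' = a"
    and e4: "w4 \<cdot> u = u' \<cdot> \<delta>"
    using epi_refine[OF \<delta>_epi, of u] by auto
  define n where "n = w4 \<cdot> (w3 \<cdot> y) \<boxminus> u' \<cdot> \<alpha>"
  have n [simp]: "n \<in> Ar C" "Dom C n = Dom C w4" "Cod C n = b" by (simp_all add: n_def)
  have "w4 \<cdot> (w3 \<cdot> (y \<cdot> \<epsilon>)) = u' \<cdot> (\<alpha> \<cdot> \<epsilon>)"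
    by (simp add: e3 Cmp_assoc_eq[OF e4] squares)
  then have n\<epsilon>: "n \<cdot> \<epsilon> = Zer C (Dom C w4) f"
    using diff_eq_Zer[of "w4 \<cdot> (w3 \<cdot> (y \<cdot> \<epsilon>))" "u' \<cdot> (\<alpha> \<cdot> \<epsilon>)"]
    by (simp add: n_def Cmp_diff_left)
  have n\<beta>: "n \<cdot> \<beta> = w4 \<cdot> (w3 \<cdot> (w2 \<cdot> (w1 \<cdot> (t \<cdot> (incl \<cdot> \<beta>)))))"
    by (simp add: n_def Cmp_diff_left complexes diff_Zer y\<beta>) (simp add: x_def)
  have "is_epi C (w4 \<cdot> (w3 \<cdot> (w2 \<cdot> w1)))"
    by (intro epi_Cmp) auto
  with n\<epsilon> n\<beta> show "image_from_ker t"
    unfolding image_from_ker_def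
    by (intro exI[of _ "w4 \<cdot> (w3 \<cdot> (w2 \<cdot> w1))"] exI[of _ n]) (simp add: Hom_iff)
next
  let ?l = "Ker_map C (\<beta> \<cdot> \<zeta>) \<iota> \<epsilon>" let ?m = "Ker_map C \<beta> \<iota> \<epsilon>"
  assume "image_from_ker t"
  then obtain w n where w: "is_epi C w" and [simp]: "Cod C w = Dom C t" "n \<in> Ar C" "Dom C n = Dom C w" "Cod C n = b"
    and n: "n \<cdot> \<epsilon> = Zer C (Dom C w) f" "w \<cdot> (t \<cdot> (incl \<cdot> \<beta>)) = n \<cdot> \<beta>"
    by (auto simp: image_from_ker_def Hom_iff)
  note [simp] = epi_arrow[OF w]
  define y where "y = w \<cdot> (t \<cdot> incl) \<boxminus> n"
  have y [simp]: "y \<in> Ar C" "Dom C y = Dom C w" "Cod C y = b" by (simp_all add: y_def)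
  have "y \<cdot> \<beta> = Zer C (Dom C w) c"
    using diff_eq_Zer[of "w \<cdot> (t \<cdot> (incl \<cdot> \<beta>))" "n \<cdot> \<beta>"] n(2)
    by (simp add: y_def Cmp_diff_left)
  then obtain z where z [simp]: "z \<in> Ar C" "Dom C z = Dom C w" "Cod C z = Ker C \<beta>" and zy: "z \<cdot> ker C \<beta> = y"
    using ker_lift[of \<beta> y] by auto
  have "w \<cdot> (t \<cdot> ?l) = z \<cdot> ?m"
  proof (rule mono_cancel[of "ker C \<iota>"])
    have "y \<cdot> \<epsilon> = w \<cdot> (t \<cdot> (incl \<cdot> \<epsilon>))"
      by (simp add: y_def Cmp_diff_left n(1) diff_Zer)
    then show "(w \<cdot> (t \<cdot> ?l)) \<cdot> ker C \<iota> = (z \<cdot> ?m) \<cdot> ker C \<iota>"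
      by (simp add: lift_\<epsilon>_ker ker\<beta>_ker Cmp_assoc_eq[OF zy])
  qed auto
  note eq = Cmp_assoc_eq[OF this, of "H_epi C \<theta> \<iota> \<cdot> coker C H\<epsilon>"]
  have "w \<cdot> (t \<cdot> (right \<cdot> coker C H\<epsilon>)) = z \<cdot> (?m \<cdot> (H_epi C \<theta> \<iota> \<cdot> coker C H\<epsilon>))"
    using eq by (simp add: right_def)
  also have "\<dots> = z \<cdot> (H_epi C \<alpha> \<beta> \<cdot> (H\<epsilon> \<cdot> coker C H\<epsilon>))"
    by (simp add: Cmp_assoc_eq[OF H\<epsilon>_epi] del: coker_arrow(4))
  also have "\<dots> = Zer C (Dom C w) (Coker C H\<epsilon>)" by simp
  finally show "t \<cdot> (right \<cdot> coker C H\<epsilon>) = Zer C (Dom C t) (Coker C H\<epsilon>)"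
    using epi_zero[OF w, of "t \<cdot> (right \<cdot> coker C H\<epsilon>)"] by simp
qed

lemma homology_embeds: "\<exists>m. is_mono C m \<and> m \<in> Hom C (H C kmap kclass) (Coker C H\<epsilon>)"
proof -
  have e: "is_epi C (left \<cdot> H_epi C kmap kclass)"
    by (intro epi_Cmp left_epi) auto
  obtain m where "is_mono C m" "Dom C m = H C kmap kclass" "Cod C m = Coker C H\<epsilon>"
  proof (rule mono_if_same_points[OF e, of "right \<cdot> coker C H\<epsilon>"])
    fix x assume x: "x \<in> Ar C" "Cod C x = Dom C (left \<cdot> H_epi C kmap kclass)"
    then show "(x \<cdot> (left \<cdot> H_epi C kmap kclass) = Zer C (Dom C x) (Cod C (left \<cdot> H_epi C kmap kclass))) =
        (x \<cdot> (right \<cdot> coker C H\<epsilon>) = Zer C (Dom C x) (Cod C (right \<cdot> coker C H\<epsilon>)))"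
      using H_epi_zero_iff[of kmap kclass "x \<cdot> left"] image_from_ker_iff_left[of x] image_from_ker_iff_right[of x] by simp
  qed auto
  then show ?thesis by (auto simp: Hom_iff mono_arrow)
qed

text \<open>Each quotient of consecutive steps is obtained from \<open>subquotient_if_points\<close>, applied to
  epimorphisms from \<open>Ker \<epsilon>\<close>, \<open>K\<close> and \<open>Ker \<zeta>\<close>, respectively.\<close>

lemma filtration_exists:
  "\<exists>F. filtration C (Ker C \<zeta>) 3 F \<and>
        subquotient C (graded_part C F 0) (Ker C \<epsilon>) \<and>
        subquotient C (graded_part C F 1) (H C \<theta> \<iota>) \<and>
        subquotient C (graded_part C F 2) (H C \<beta> \<gamma>)"
proof -
  obtain z where z: "zero_object C z" using zero_object_exists by blast
  then have z_Ob [simp]: "z \<in> Ob C" by (simp add: zero_object_iff)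
  let ?I = "Dom C (im C kmap)" and ?Z = "Ker C \<zeta>"
  obtain u where u: "is_epi C u" "Dom C u = Ker C \<epsilon>" "Cod C u = ?I" and uN: "u \<cdot> im C kmap = kmap"
    using image_factorization[of kmap] by auto
  note [simp] = epi_arrow[OF u(1)] u(2,3)
  have Nv: "kmap \<cdot> kclass = Zer C (Ker C \<epsilon>) (H C \<beta> \<gamma>)"
    using kclass_zero_iff[of kmap] by (simp add: Cmp_assoc_eq[OF kmap_arrow(4)])
  have "u \<cdot> (im C kmap \<cdot> kclass) = Zer C (Ker C \<epsilon>) (H C \<beta> \<gamma>)"
    by (simp add: Cmp_assoc_eq[OF uN] Nv)
  then have "im C kmap \<cdot> kclass = Zer C ?I (H C \<beta> \<gamma>)"
    using epi_zero[OF u(1), of "im C kmap \<cdot> kclass"] by simp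
  then obtain i where i [simp]: "i \<in> Ar C" "Dom C i = ?I" "Cod C i = Ker C kclass"
    and iv: "i \<cdot> ker C kclass = im C kmap"
    using ker_lift[of kclass "im C kmap"] by auto
  define F where "F n = (if n = 0 then Zer C z ?Z else if n = 1 then im C kmap
    else if n = 2 then ker C kclass else Ide C ?Z)" for n :: nat
  have F [simp]: "F 0 = Zer C z ?Z" "F (Suc 0) = im C kmap" "F 2 = ker C kclass" "F 3 = Ide C ?Z"
    by (simp_all add: F_def)
  have F0: "is_mono C (Zer C z ?Z)"
    using zero_object_Cod[OF z] by (intro mono_zeroI) auto
  have r0: "factor_right C (F 1) (F 0) = Zer C z ?I"
    by (rule factor_right_eq) auto
  have r1: "factor_right C (F 2) (F 1) = i"
    by (rule factor_right_eq) (auto simp: iv)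
  have r2: "factor_right C (F 3) (F 2) = ker C kclass"
    by (rule factor_right_eq) (auto simp: Ide_mono)
  have le3: "n \<le> 3 \<longleftrightarrow> n = 0 \<or> n = 1 \<or> n = 2 \<or> n = 3"
    and less3: "n < 3 \<longleftrightarrow> n = 0 \<or> n = 1 \<or> n = 2" for n :: nat by auto
  have "filtration C ?Z 3 F"
    unfolding filtration_def
  proof (intro conjI allI impI)
    fix n :: nat
    show "is_mono C (F n)" if "n \<le> 3" using that F0 by (auto simp: le3 Ide_mono)
    show "Cod C (F n) = ?Z" if "n \<le> 3" using that by (auto simp: le3)
    show "\<exists>u\<in>Hom C (Dom C (F n)) (Dom C (F (Suc n))). u \<cdot> F (Suc n) = F n" if "n < 3"
      using that unfolding less3
    proof (elim disjE)
      assume "n = 0"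
      then show ?thesis by (intro bexI[of _ "Zer C z ?I"]) (auto simp: Hom_iff)
    next
      assume "n = 1"
      then show ?thesis by (intro bexI[of _ i]) (auto simp: Hom_iff iv numeral_2_eq_2[symmetric])
    next
      assume "n = 2"
      then show ?thesis by (intro bexI[of _ "ker C kclass"]) (auto simp: Hom_iff numeral_3_eq_3[symmetric])
    qed
    show "zero_object C (Dom C (F 0))" using z by simp
    show "is_iso C (F 3)" by (simp add: Ide_iso)
  qed
  moreover have "subquotient C (graded_part C F 0) (Ker C \<epsilon>)"
  proof -
    let ?q = "u \<cdot> coker C (Zer C z ?I)"
    have "is_epi C ?q" by (intro epi_Cmp u) auto
    then have "subquotient C (Cod C ?q) (Cod C (Ide C (Ker C \<epsilon>)))"
    proof (rule subquotient_if_points)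
      fix x assume x: "x \<in> Ar C" "Cod C x = Dom C ?q"
        "x \<cdot> Ide C (Ker C \<epsilon>) = Zer C (Dom C x) (Cod C (Ide C (Ker C \<epsilon>)))"
      then have "Zer C (Dom C x) (Ker C \<epsilon>) = x" by simp
      moreover have "Zer C (Dom C x) (Ker C \<epsilon>) \<cdot> ?q = Zer C (Dom C x) (Cod C ?q)"
        using x(1) by simp
      ultimately show "x \<cdot> ?q = Zer C (Dom C x) (Cod C ?q)" by (simp only:)
    qed simp_all
    then show ?thesis using r0 by (simp add: graded_part_def)
  qed
  moreover have "subquotient C (graded_part C F 1) (H C \<theta> \<iota>)"
  proof -
    let ?q = "left \<cdot> coker C i"
    have "is_epi C ?q" by (intro epi_Cmp left_epi) auto
    then have "subquotient C (Cod C ?q) (Cod C right)"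
    proof (rule subquotient_if_points)
      fix x assume "x \<in> Ar C" "Cod C x = Dom C ?q" and 0: "x \<cdot> right = Zer C (Dom C x) (Cod C right)"
      then have x [simp]: "x \<in> Ar C" "Cod C x = K" by simp_all
      have "x \<cdot> (right \<cdot> coker C H\<epsilon>) = Zer C (Dom C x) (Coker C H\<epsilon>)"
        by (simp add: Cmp_assoc_eq[OF 0])
      then have "(x \<cdot> (left \<cdot> ker C kclass)) \<cdot> coker C kmap = Zer C (Dom C x) (Coker C kmap)"
        by (simp add: image_from_ker_iff_left image_from_ker_iff_right)
      then obtain y where y [simp]: "y \<in> Ar C" "Dom C y = Dom C x" "Cod C y = ?I"
        and "y \<cdot> im C kmap = x \<cdot> (left \<cdot> ker C kclass)"
        using im_lift[of kmap "x \<cdot> (left \<cdot> ker C kclass)"] by auto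
      then have "x \<cdot> left = y \<cdot> i"
        by (intro mono_cancel[of "ker C kclass" "x \<cdot> left" "y \<cdot> i"]) (auto simp: iv)
      then show "x \<cdot> ?q = Zer C (Dom C x) (Cod C ?q)"
        using Cmp_assoc_eq[of x left "y \<cdot> i" "coker C i"] by simp
    qed simp_all
    then show ?thesis using r1 by (simp add: graded_part_def numeral_2_eq_2[symmetric])
  qed
  moreover have "subquotient C (graded_part C F 2) (H C \<beta> \<gamma>)"
  proof -
    let ?q = "coker C (ker C kclass)"
    have "is_epi C ?q" by simp
    then have "subquotient C (Cod C ?q) (Cod C kclass)"
    proof (rule subquotient_if_points)
      fix x assume "x \<in> Ar C" "Cod C x = Dom C ?q" "x \<cdot> kclass = Zer C (Dom C x) (Cod C kclass)"
      then obtain y where [simp]: "y \<in> Ar C" "Dom C y = Dom C x" "Cod C y = Ker C kclass" and y: "y \<cdot> ker C kclass = x"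
        using ker_lift[of kclass x] by auto
      have "x \<cdot> ?q = y \<cdot> (ker C kclass \<cdot> ?q)" 
        unfolding y[symmetric] by (rule Cmp_assoc') auto
      then show "x \<cdot> ?q = Zer C (Dom C x) (Cod C ?q)" by simp
    qed simp_all
    then show ?thesis using r2 by (simp add: graded_part_def numeral_3_eq_3[symmetric])
  qed
  ultimately show ?thesis by blast
qed

text \<open>If \<open>H(\<beta>, \<gamma>) = 0\<close>, then \<open>Ker kclass\<close> is all of \<open>Ker \<zeta>\<close>. If \<open>H(\<theta>, \<iota>) = 0\<close>, then the universal
  point of \<open>K\<close>, its identity, is killed by \<open>right\<close>, so the image of \<open>Ker \<epsilon>\<close> is also everything.\<close>

lemma \<zeta>_mono:
  assumes zeros: "zero_object C (Ker C \<epsilon>)" "zero_object C (H C \<beta> \<gamma>)" "zero_object C (H C \<theta> \<iota>)"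
  shows "is_mono C \<zeta>"
proof -
  have "kclass = Zer C (Ker C \<zeta>) (H C \<beta> \<gamma>)"
    using zero_object_Cod[OF zeros(2), of kclass] by simp
  then obtain r where [simp]: "r \<in> Ar C" "Dom C r = Ker C \<zeta>" "Cod C r = Ker C kclass"
    and r: "r \<cdot> ker C kclass = Ide C (Ker C \<zeta>)"
    using ker_lift[of kclass "Ide C (Ker C \<zeta>)"] by auto
  have "right = Zer C K (H C \<theta> \<iota>)"
    using zero_object_Cod[OF zeros(3), of right] by simp
  then have "image_from_ker (Ide C K)"
    using image_from_ker_iff_right[of "Ide C K"] by simp
  then have "left \<cdot> (ker C kclass \<cdot> coker C kmap) = Zer C K (Coker C kmap)"
    using image_from_ker_iff_left[of "Ide C K"] by simp
  then have "ker C kclass \<cdot> coker C kmap = Zer C (Ker C kclass) (Coker C kmap)"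
    using epi_zero[OF left_epi, of "ker C kclass \<cdot> coker C kmap"] by simp
  then have "r \<cdot> (ker C kclass \<cdot> coker C kmap) = Zer C (Ker C \<zeta>) (Coker C kmap)" by simp
  then have q0: "coker C kmap = Zer C (Ker C \<zeta>) (Coker C kmap)"
    by (simp add: Cmp_assoc_eq[OF r])
  have "kmap = Zer C (Ker C \<epsilon>) (Ker C \<zeta>)"
    using zero_object_Dom[OF zeros(1), of kmap] by simp
  then have "kmap \<cdot> Ide C (Ker C \<zeta>) = Zer C (Ker C \<epsilon>) (Ker C \<zeta>)" by simp
  then obtain y where "y \<in> Ar C" "Dom C y = Coker C kmap" "Cod C y = Ker C \<zeta>"
    and y: "coker C kmap \<cdot> y = Ide C (Ker C \<zeta>)"
    using coker_lift[of kmap "Ide C (Ker C \<zeta>)"] by auto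
  then have "Ide C (Ker C \<zeta>) = Zer C (Ker C \<zeta>) (Ker C \<zeta>)"
    using Zer_Cmp[of "Ker C \<zeta>" y "Coker C kmap"] q0 by simp
  then show ?thesis
    using zero_Ker_iff_mono[of \<zeta>] by (simp add: zero_object_iff)
qed

end
theorem lemma2p17:
  fixes C :: "('o, 'm, 'r) preadditive_data_scheme" (structure)
    and a b c d e f g h :: 'o
    and \<alpha> \<beta> \<gamma> \<theta> \<iota> \<kappa> \<delta> \<epsilon> \<zeta> \<eta> :: 'm
  assumes "abelian_category C"
    and "\<alpha> \<in> Hom C a b" and "\<beta> \<in> Hom C b c" and "\<gamma> \<in> Hom C c d"
    and "\<theta> \<in> Hom C e f" and "\<iota> \<in> Hom C f g" and "\<kappa> \<in> Hom C g h"
    and "\<delta> \<in> Hom C a e" and "\<epsilon> \<in> Hom C b f" and "\<zeta> \<in> Hom C c g" and "\<eta> \<in> Hom C d h"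
    and "\<alpha> \<cdot> \<epsilon> = \<delta> \<cdot> \<theta>" and "\<beta> \<cdot> \<zeta> = \<epsilon> \<cdot> \<iota>" and "\<gamma> \<cdot> \<eta> = \<zeta> \<cdot> \<kappa>"
    and "\<alpha> \<cdot> \<beta> = Zer C a c" and "\<beta> \<cdot> \<gamma> = Zer C b d"
    and "\<theta> \<cdot> \<iota> = Zer C e g" and "\<iota> \<cdot> \<kappa> = Zer C f h"
    and "is_epi C \<delta>" and "is_mono C \<eta>"
  shows
    "(\<exists>m. is_mono C m \<and>
        m \<in> Hom C
          (H C (Ker_map C \<epsilon> \<zeta> \<beta>) (factor_right C (ker C \<gamma>) (ker C \<zeta>) \<cdot> H_epi C \<beta> \<gamma>))
          (Coker C (H_map C \<alpha> \<beta> \<theta> \<iota> \<epsilon>))) \<and>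
     (\<exists>F. filtration C (Ker C \<zeta>) 3 F \<and>
        subquotient C (graded_part C F 0) (Ker C \<epsilon>) \<and>
        subquotient C (graded_part C F 1) (H C \<theta> \<iota>) \<and>
        subquotient C (graded_part C F 2) (H C \<beta> \<gamma>)) \<and>
     (zero_object C (Ker C \<epsilon>) \<and> zero_object C (H C \<beta> \<gamma>) \<and> zero_object C (H C \<theta> \<iota>) \<longleftrightarrow>
        is_mono C \<epsilon> \<and> exact C \<beta> \<gamma> \<and> exact C \<theta> \<iota>) \<and>
     (zero_object C (Ker C \<epsilon>) \<and> zero_object C (H C \<beta> \<gamma>) \<and> zero_object C (H C \<theta> \<iota>) \<longrightarrow>
        is_mono C \<zeta>)"
proof -
  interpret ladder C a b c d e f g h \<alpha> \<beta> \<gamma> \<theta> \<iota> \<kappa> \<delta> \<epsilon> \<zeta> \<eta>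
    using assms by (simp add: ladder_def ladder_axioms_def)
  show ?thesis
    using homology_embeds filtration_exists \<zeta>_mono
      zero_Ker_iff_mono[of \<epsilon>] exact_iff_zero_H[of \<beta> \<gamma>] exact_iff_zero_H[of \<theta> \<iota>] complexes
    by (simp add: kmap_def kclass_def)
qed

end
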